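(* Let $u,w\in\mathcal{D}(E)$ be such that $T=M_wEM_u$ is a bounded operator on $L^2(\Sigma)$, and let $p\in(0,\infty)$. Then: (a) If $|E(uw)|^2\ge E(|u|^2)E(|w|^2)$, then $T$ is $p$-quasihyponormal. (b) If $T$ is $p$-quasihyponormal, then $|E(uw)|^2\ge E(|u|^2)E(|w|^2)$ on $S(E(u))\cap G$, where $G=S(E(|w|^2))$. (c) If $S(w)=S(u)=X$, then $T$ is $p$-quasihyponormal if and only if $|E(uw)|^2\ge E(|u|^2)E(|w|^2)$.
   Context: $(X,\Sigma,\mu)$ is a complete $\sigma$-finite measure space and $\mathcal{A}\subseteq\Sigma$ is a $\sigma$-subalgebra such that $\mu|_{\mathcal{A}}$ is $\sigma$-finite. $L^2(\Sigma)=L^2(X,\Sigma,\mu)$ (complex-valued functions). $L^0(\Sigma)$ (resp. $L^0(\mathcal{A})$) denotes the a.e. finite valued $\Sigma$-measurable (resp. $\mathcal{A}$-measurable) functions modulo null sets. All comparisons between functions or sets are up to $\mu$-null sets. The support of a measurable function $f$ is $S(f)=\{x\in X: f(x)\ne 0\}$. $E=E^{\mathcal{A}}$ is the conditional expectation: for $f\ge 0$ measurable or $f\in L^2(\Sigma)$, $E(f)$ is the unique $\mathcal{A}$-measurable function with $\int_A f\,d\mu=\int_A E(f)\,d\mu$ for all $A\in\mathcal{A}$ (for which the integrals are defined). $\mathcal{D}(E)=\{g\in L^0(\Sigma): E(|g|)\in L^0(\mathcal{A})\}$, on which $E$ is defined by linearity. $M_wEM_u$ is the operator $f\mapsto wE(uf)$.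 For $0<p<\infty$, a bounded operator $T$ is $p$-quasihyponormal if $T^*(T^*T)^pT\ge T^*(TT^* )^pT$. *)

theory Defs
  imports "HOL-Probability.Probability"
begin

section \<open>Conditional expectation of complex-valued functions\<close>

text \<open>
  The domain \<open>D(E)\<close>: measurable functions \<open>g\<close> for which \<open>E(|g|)\<close> is finite almost everywhere.
  Elements of \<open>L\<^sup>0\<close> are represented by everywhere finite measurable functions; equality
  and comparison are always almost everywhere.
\<close>
definition cond_exp_dom :: "'a measure \<Rightarrow> 'a measure \<Rightarrow> ('a \<Rightarrow> complex) set" where
  "cond_exp_dom M F = {g \<in> borel_measurable M.
     AE x in M. nn_cond_exp M F (\<lambda>y. ennreal (cmod (g y))) x < \<infinity>}"

text \<open>
  The extension of the conditional expectation to complex functions by linearity. It is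
  meaningful on \<open>cond_exp_dom M F\<close> only.
\<close>
definition complex_cond_exp :: "'a measure \<Rightarrow> 'a measure \<Rightarrow> ('a \<Rightarrow> complex) \<Rightarrow> 'a \<Rightarrow> complex" where
  "complex_cond_exp M F g x =
     Complex (real_cond_exp M F (\<lambda>y. Re (g y)) x) (real_cond_exp M F (\<lambda>y. Im (g y)) x)"

text \<open>
  \<open>E(|g|\<^sup>2)\<close>, with values in \<open>[0,\<infinity>]\<close>: for \<open>g\<close> in the domain of \<open>E\<close> it may be infinite.
\<close>
definition cond_exp_sq :: "'a measure \<Rightarrow> 'a measure \<Rightarrow> ('a \<Rightarrow> complex) \<Rightarrow> 'a \<Rightarrow> ennreal" where
  "cond_exp_sq M F g = nn_cond_exp M F (\<lambda>y. ennreal ((cmod (g y))\<^sup>2))"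

definition weighted_cond_op ::
  "'a measure \<Rightarrow> 'a measure \<Rightarrow> ('a \<Rightarrow> complex) \<Rightarrow> ('a \<Rightarrow> complex) \<Rightarrow> ('a \<Rightarrow> complex) \<Rightarrow> 'a \<Rightarrow> complex" where
  "weighted_cond_op M F w u f x = w x * complex_cond_exp M F (\<lambda>y. u y * f y) x"

section \<open>Bounded operators on the complex Hilbert space \<open>L\<^sup>2\<close>\<close>

text \<open>
  Vectors are square-integrable functions, identified when they agree almost everywhere;
  an operator is a map on representatives.
\<close>
definition L2 :: "'a measure \<Rightarrow> ('a \<Rightarrow> complex) set" where
  "L2 M = {f \<in> borel_measurable M. integrable M (\<lambda>x. (cmod (f x))\<^sup>2)}"

definition L2_inner :: "'a measure \<Rightarrow> ('a \<Rightarrow> complex) \<Rightarrow> ('a \<Rightarrow> complex) \<Rightarrow> complex" where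
  "L2_inner M f g = (LINT x|M. f x * cnj (g x))"

definition L2_norm :: "'a measure \<Rightarrow> ('a \<Rightarrow> complex) \<Rightarrow> real" where
  "L2_norm M f = sqrt (LINT x|M. (cmod (f x))\<^sup>2)"

type_synonym 'a fun_op = "('a \<Rightarrow> complex) \<Rightarrow> 'a \<Rightarrow> complex"

text \<open>
  Linearity (almost everywhere) and boundedness imply that a bounded operator maps
  almost everywhere equal functions to almost everywhere equal functions.
\<close>
definition L2_bounded :: "'a measure \<Rightarrow> 'a fun_op \<Rightarrow> bool" where
  "L2_bounded M A \<longleftrightarrow>
     (\<forall>f\<in>L2 M. A f \<in> L2 M) \<and>
     (\<forall>f\<in>L2 M. \<forall>g\<in>L2 M. AE x in M. A (\<lambda>y. f y + g y) x = A f x + A g x) \<and>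
     (\<forall>f\<in>L2 M. \<forall>c. AE x in M. A (\<lambda>y. c * f y) x = c * A f x) \<and>
     (\<exists>C. \<forall>f\<in>L2 M. L2_norm M (A f) \<le> C * L2_norm M f)"

definition L2_opnorm :: "'a measure \<Rightarrow> 'a fun_op \<Rightarrow> real" where
  "L2_opnorm M A = Inf {C. 0 \<le> C \<and> (\<forall>f\<in>L2 M. L2_norm M (A f) \<le> C * L2_norm M f)}"

text \<open>Determined up to almost everywhere equality of the values.\<close>
definition L2_adjoint :: "'a measure \<Rightarrow> 'a fun_op \<Rightarrow> 'a fun_op" where
  "L2_adjoint M A = (SOME B. L2_bounded M B \<and>
     (\<forall>f\<in>L2 M. \<forall>g\<in>L2 M. L2_inner M (A f) g = L2_inner M f (B g)))"

text \<open>
  The order \<open>A \<le> B\<close>: the operator \<open>B - A\<close> is positive.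
\<close>
definition L2_op_le :: "'a measure \<Rightarrow> 'a fun_op \<Rightarrow> 'a fun_op \<Rightarrow> bool" where
  "L2_op_le M A B \<longleftrightarrow> (\<forall>f\<in>L2 M. L2_inner M (\<lambda>x. B f x - A f x) f \<in> \<real>\<^sub>\<ge>\<^sub>0)"

definition op_poly :: "real poly \<Rightarrow> 'a fun_op \<Rightarrow> 'a fun_op" where
  "op_poly q A f x = (\<Sum>i\<le>degree q. complex_of_real (coeff q i) * (A ^^ i) f x)"

text \<open>
  The power \<open>A\<^sup>p\<close> (real \<open>p > 0\<close>) of a positive bounded operator \<open>A\<close>, by the continuous
  functional calculus for the function \<open>t \<mapsto> t\<^sup>p\<close> on \<open>[0, \<parallel>A\<parallel>]\<close>, which contains the spectrum
  of \<open>A\<close>: it is the limit in operator norm of \<open>q\<^sub>n(A)\<close> for polynomials \<open>q\<^sub>n\<close> converging uniformly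
  to \<open>t\<^sup>p\<close> on that interval. Note that \<open>0 powr p = 0\<close>. Like the adjoint, it is determined up to
  almost everywhere equality of the values.
\<close>
definition L2_op_powr :: "'a measure \<Rightarrow> 'a fun_op \<Rightarrow> real \<Rightarrow> 'a fun_op" where
  "L2_op_powr M A p = (SOME B. L2_bounded M B \<and>
     (\<forall>q :: nat \<Rightarrow> real poly.
        uniform_limit {0..L2_opnorm M A} (\<lambda>n t. poly (q n) t) (\<lambda>t. t powr p) sequentially \<longrightarrow>
        (\<lambda>n. L2_opnorm M (\<lambda>f x. op_poly (q n) A f x - B f x)) \<longlonglongrightarrow> 0))"

text \<open>\<open>T\<^sup>*(TT\<^sup>*)\<^sup>pT \<le> T\<^sup>*(T\<^sup>*T)\<^sup>pT\<close>\<close>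
definition p_quasihyponormal :: "'a measure \<Rightarrow> real \<Rightarrow> 'a fun_op \<Rightarrow> bool" where
  "p_quasihyponormal M p T \<longleftrightarrow>
     L2_bounded M T \<and>
     L2_op_le M
       (L2_adjoint M T \<circ> L2_op_powr M (T \<circ> L2_adjoint M T) p \<circ> T)
       (L2_adjoint M T \<circ> L2_op_powr M (L2_adjoint M T \<circ> T) p \<circ> T)"

end

theory Submission
  imports Defs
begin

text \<open>
  Write \<open>a = E(|u|\<^sup>2)\<close>, \<open>h = E(|w|\<^sup>2)\<close>, \<open>e = E(uw)\<close> and \<open>T f = w E(u f)\<close>. The key is that
  \<open>p\<close>-quasihyponormality of \<open>T\<close> is equivalent to \<open>|e|\<^sup>2 \<ge> a h\<close> almost everywhere
  (\<open>p_quasihyponormal_iff\<close>); the three parts are read off from this equivalence.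

  Operators \<open>f \<mapsto> w E(u f)\<close>, with weights \<open>w, u\<close>, are closed under all the operations that the definition of
  quasihyponormality uses. The adjoint has weights \<open>cnj u, cnj w\<close> (\<open>adjoint_acts_as\<close>), because \<open>E\<close>
  is symmetric. The product of the operators with weights \<open>w, u\<close> and \<open>w', u'\<close> has weights
  \<open>w E(u w'), u'\<close> (\<open>acts_as_comp\<close>), because \<open>E(u' f)\<close> can be pulled out of \<open>E\<close>. Hence \<open>T\<^sup>*T\<close> has weights
  \<open>h cnj u, u\<close> and \<open>TT\<^sup>*\<close> has weights \<open>a w, cnj w\<close>. An operator with weights \<open>k cnj v, v\<close>, \<open>k \<ge> 0\<close>, acts on
  the range of \<open>f \<mapsto> cnj v E(v f)\<close> as multiplication by \<open>s = k E(|v|\<^sup>2)\<close>, so its \<open>p\<close>-th power has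
  weights \<open>cnj v s\<^sup>p / E(|v|\<^sup>2), v\<close> (\<open>op_powr_acts_as\<close>). Altogether
  \<open>T\<^sup>*(T\<^sup>*T)\<^sup>pT - T\<^sup>*(TT\<^sup>*)\<^sup>pT\<close> has weights \<open>\<Delta> cnj u, u\<close> with \<open>\<Delta> = (a h)\<^sup>p (|e|\<^sup>2/a - h)\<close>, and its quadratic form
  at \<open>f\<close> is \<open>\<integral> \<Delta> |E(u f)|\<^sup>2\<close>. If \<open>|e|\<^sup>2 \<ge> a h\<close>, then \<open>\<Delta> \<ge> 0\<close> and the form is nonnegative. Conversely,
  \<open>f = cnj u 1\<^sub>D\<close> with \<open>D\<close> in the subalgebra gives \<open>\<integral>\<^sub>D \<Delta> a\<^sup>2 \<ge> 0\<close> for all these \<open>D\<close>, hence \<open>\<Delta> \<ge> 0\<close> where \<open>a > 0\<close>.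
  This is \<open>|e|\<^sup>2 \<ge> a h\<close> where \<open>a\<close> and \<open>h\<close> are positive, and elsewhere \<open>a h = 0\<close>.

  The weights are only known to lie in the domain of \<open>E\<close>, so \<open>a\<close> and \<open>h\<close> may be infinite. Testing the
  boundedness of \<open>T\<close> on truncations of \<open>cnj u\<close> shows that \<open>a h\<close> is essentially bounded, where
  \<open>0 \<cdot> \<infinity> = 0\<close> (\<open>Esq_mult_Esq_le\<close>). So \<open>a\<close> is finite where \<open>h \<noteq> 0\<close> and \<open>h\<close> is finite where \<open>a \<noteq> 0\<close>, and
  restricting \<open>u\<close> to \<open>{h \<noteq> 0}\<close> and \<open>w\<close> to \<open>{a \<noteq> 0}\<close> changes neither \<open>T\<close> nor \<open>a h\<close> nor \<open>e\<close>. With \<open>a\<close> and \<open>h\<close>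
  finite, every function that is averaged is a product of two conditionally square-integrable
  functions, and the conditional Cauchy-Schwarz inequality \<open>|E(u f)|\<^sup>2 \<le> E(|u|\<^sup>2) E(|f|\<^sup>2)\<close> gives all
  the bounds that are needed.
\<close>

section \<open>Square-integrable functions and bounded operators\<close>

lemma borel_measurable_cnj [measurable (raw)]:
  "f \<in> borel_measurable M \<Longrightarrow> (\<lambda>x. cnj (f x)) \<in> borel_measurable M"
  by (rule measurable_compose[OF _ borel_measurable_continuous_onI]) (auto intro: continuous_intros)

lemma L2_iff: "f \<in> L2 M \<longleftrightarrow> f \<in> borel_measurable M \<and> (\<integral>\<^sup>+x. ennreal ((cmod (f x))\<^sup>2) \<partial>M) < \<infinity>"
  by (auto simp: L2_def integrable_iff_bounded)

lemma L2_measurable: "f \<in> L2 M \<Longrightarrow> f \<in> borel_measurable M"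
  by (simp add: L2_def)

lemma L2_norm_nonneg: "0 \<le> L2_norm M f"
  by (simp add: L2_norm_def)

lemma L2_norm_square: "(L2_norm M f)\<^sup>2 = (LINT x|M. (cmod (f x))\<^sup>2)"
  by (simp add: L2_norm_def)

lemma nn_integral_L2_norm:
  assumes "f \<in> L2 M"
  shows "(\<integral>\<^sup>+x. ennreal ((cmod (f x))\<^sup>2) \<partial>M) = ennreal ((L2_norm M f)\<^sup>2)"
  unfolding L2_norm_square
  by (rule nn_integral_eq_integral) (use assms in \<open>auto simp: L2_def\<close>)

lemma L2_norm_le_nn_integral:
  assumes "f \<in> borel_measurable M" "0 \<le> c" "(\<integral>\<^sup>+x. ennreal ((cmod (f x))\<^sup>2) \<partial>M) \<le> ennreal (c\<^sup>2)"
  shows "f \<in> L2 M" "L2_norm M f \<le> c"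
proof -
  show L: "f \<in> L2 M" using assms by (auto simp: L2_iff intro: le_less_trans)
  have "(L2_norm M f)\<^sup>2 \<le> c\<^sup>2"
    using assms(3) unfolding nn_integral_L2_norm[OF L] by simp
  then show "L2_norm M f \<le> c" using assms(2) power2_le_imp_le by blast
qed

lemma L2_scale:
  assumes "f \<in> L2 M" shows "(\<lambda>x. c * f x) \<in> L2 M" "L2_norm M (\<lambda>x. c * f x) = cmod c * L2_norm M f"
  using assms by (auto simp: L2_def L2_norm_def norm_mult power_mult_distrib real_sqrt_mult)

lemma cmod_add_square_le: "(cmod (a + b))\<^sup>2 \<le> 2 * (cmod a)\<^sup>2 + 2 * (cmod b)\<^sup>2"
proof -
  have "(cmod (a + b))\<^sup>2 \<le> (cmod a + cmod b)\<^sup>2"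
    by (intro power_mono norm_triangle_ineq) simp
  also have "\<dots> \<le> 2 * (cmod a)\<^sup>2 + 2 * (cmod b)\<^sup>2"
    using sum_squares_bound[of "cmod a" "cmod b"] by (simp add: power2_sum)
  finally show ?thesis .
qed

lemma cmod_mult_le_squares: "cmod (a * b) \<le> (cmod a)\<^sup>2 + (cmod b)\<^sup>2"
proof -
  have "0 \<le> cmod a * cmod b" by simp
  then show ?thesis using sum_squares_bound[of "cmod a" "cmod b"] unfolding norm_mult by linarith
qed

text \<open>
  This weak form of the triangle inequality suffices, as norms are only compared up to constants.
\<close>
lemma L2_add:
  assumes "f \<in> L2 M" "g \<in> L2 M"
  shows "(\<lambda>x. f x + g x) \<in> L2 M"
    "(L2_norm M (\<lambda>x. f x + g x))\<^sup>2 \<le> 2 * (L2_norm M f)\<^sup>2 + 2 * (L2_norm M g)\<^sup>2"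
proof -
  have [measurable]: "f \<in> borel_measurable M" "g \<in> borel_measurable M"
    and i: "integrable M (\<lambda>x. (cmod (f x))\<^sup>2)" "integrable M (\<lambda>x. (cmod (g x))\<^sup>2)"
    using assms by (auto simp: L2_def)
  have ii: "integrable M (\<lambda>x. 2 * (cmod (f x))\<^sup>2 + 2 * (cmod (g x))\<^sup>2)"
    using i by auto
  have iii: "integrable M (\<lambda>x. (cmod (f x + g x))\<^sup>2)"
    by (rule Bochner_Integration.integrable_bound[OF ii]) (auto intro: cmod_add_square_le)
  then show "(\<lambda>x. f x + g x) \<in> L2 M" by (simp add: L2_def)
  have "(LINT x|M. (cmod (f x + g x))\<^sup>2) \<le> (LINT x|M. 2 * (cmod (f x))\<^sup>2 + 2 * (cmod (g x))\<^sup>2)"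
    by (rule integral_mono[OF iii ii]) (rule cmod_add_square_le)
  then show "(L2_norm M (\<lambda>x. f x + g x))\<^sup>2 \<le> 2 * (L2_norm M f)\<^sup>2 + 2 * (L2_norm M g)\<^sup>2"
    using i by (simp add: L2_norm_square)
qed

lemma L2_diff:
  assumes "f \<in> L2 M" "g \<in> L2 M"
  shows "(\<lambda>x. f x - g x) \<in> L2 M"
    "(L2_norm M (\<lambda>x. f x - g x))\<^sup>2 \<le> 2 * (L2_norm M f)\<^sup>2 + 2 * (L2_norm M g)\<^sup>2"
  using L2_add[OF assms(1) L2_scale(1)[OF assms(2), of "-1"]] L2_scale(2)[OF assms(2), of "-1"]
  by simp_all

lemma L2_cong_AE:
  assumes "f \<in> borel_measurable M" "g \<in> L2 M" "AE x in M. f x = g x"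
  shows "f \<in> L2 M"
proof -
  have "(\<integral>\<^sup>+x. ennreal ((cmod (f x))\<^sup>2) \<partial>M) = (\<integral>\<^sup>+x. ennreal ((cmod (g x))\<^sup>2) \<partial>M)"
    by (rule nn_integral_cong_AE) (use assms(3) in auto)
  with assms show ?thesis by (simp add: L2_iff)
qed

lemma L2_norm_cong_AE:
  assumes "f \<in> borel_measurable M" "g \<in> borel_measurable M" "AE x in M. f x = g x"
  shows "L2_norm M f = L2_norm M g"
  unfolding L2_norm_def
  by (rule arg_cong[where f = sqrt], rule integral_cong_AE) (use assms in auto)

lemma L2_inner_cong_AE:
  assumes "f \<in> borel_measurable M" "f' \<in> borel_measurable M" "AE x in M. f x = f' x" "g \<in> borel_measurable M"
  shows "L2_inner M f g = L2_inner M f' g"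
  unfolding L2_inner_def
  by (rule integral_cong_AE) (use assms in auto)

lemma L2_integrable_inner:
  assumes "f \<in> L2 M" "g \<in> L2 M"
  shows "integrable M (\<lambda>x. f x * cnj (g x))"
proof -
  have [measurable]: "f \<in> borel_measurable M" "g \<in> borel_measurable M"
    and i: "integrable M (\<lambda>x. (cmod (f x))\<^sup>2)" "integrable M (\<lambda>x. (cmod (g x))\<^sup>2)"
    using assms by (auto simp: L2_def)
  show ?thesis
  proof (rule Bochner_Integration.integrable_bound[OF Bochner_Integration.integrable_add[OF i]])
    show "AE x in M. norm (f x * cnj (g x)) \<le> norm ((cmod (f x))\<^sup>2 + (cmod (g x))\<^sup>2)"
      using cmod_mult_le_squares[of "f x" "cnj (g x)" for x] by simp
  qed measurable
qed

lemma L2_inner_commute: "L2_inner M f g = cnj (L2_inner M g f)"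
proof -
  have "cnj (L2_inner M g f) = (LINT x|M. cnj (g x * cnj (f x)))"
    unfolding L2_inner_def by (rule Bochner_Integration.integral_cnj[symmetric])
  then show ?thesis by (simp add: L2_inner_def mult.commute)
qed

lemma L2_norm_eq_0_imp_AE:
  assumes "f \<in> L2 M" "L2_norm M f = 0"
  shows "AE x in M. f x = 0"
proof -
  have "(\<integral>\<^sup>+x. ennreal ((cmod (f x))\<^sup>2) \<partial>M) = 0"
    using nn_integral_L2_norm[OF assms(1)] assms(2) by simp
  then show ?thesis
    using assms(1) by (subst (asm) nn_integral_0_iff_AE) (auto simp: L2_def)
qed

text \<open>
  Pair the difference \<open>B g - B' g\<close> with itself.
\<close>
lemma L2_adjoint_unique:
  assumes B: "\<And>g. g \<in> L2 M \<Longrightarrow> B g \<in> L2 M" "\<And>g. g \<in> L2 M \<Longrightarrow> B' g \<in> L2 M"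
    and adj: "\<And>f g. f \<in> L2 M \<Longrightarrow> g \<in> L2 M \<Longrightarrow> L2_inner M f (B g) = L2_inner M f (B' g)"
    and g: "g \<in> L2 M"
  shows "AE x in M. B g x = B' g x"
proof -
  define d where "d x = B g x - B' g x" for x
  have d: "d \<in> L2 M" unfolding d_def using B g by (intro L2_diff)
  have "L2_inner M d (B g) - L2_inner M d (B' g) = L2_inner M d d"
    unfolding L2_inner_def using L2_integrable_inner[OF d B(1)[OF g]] L2_integrable_inner[OF d B(2)[OF g]]
    by (subst Bochner_Integration.integral_diff[symmetric]) (auto simp: d_def algebra_simps)
  then have "L2_inner M d d = 0" using adj[OF d g] by simp
  then have "(LINT x|M. complex_of_real ((cmod (d x))\<^sup>2)) = 0"
    by (simp add: L2_inner_def complex_norm_square del: of_real_power)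
  then have "(LINT x|M. (cmod (d x))\<^sup>2) = 0" by (simp only: integral_complex_of_real of_real_eq_0_iff)
  then have "L2_norm M d = 0" by (simp add: L2_norm_def)
  from L2_norm_eq_0_imp_AE[OF d this] show ?thesis by (simp add: d_def)
qed

lemma L2_boundedI:
  assumes "\<And>f. f \<in> L2 M \<Longrightarrow> A f \<in> L2 M"
    and "\<And>f g. f \<in> L2 M \<Longrightarrow> g \<in> L2 M \<Longrightarrow> AE x in M. A (\<lambda>y. f y + g y) x = A f x + A g x"
    and "\<And>f c. f \<in> L2 M \<Longrightarrow> AE x in M. A (\<lambda>y. c * f y) x = c * A f x"
    and "\<And>f. f \<in> L2 M \<Longrightarrow> L2_norm M (A f) \<le> C * L2_norm M f"
  shows "L2_bounded M A"
  unfolding L2_bounded_def by (intro conjI ballI allI exI[of _ C] assms)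

text \<open>
  The infimum in \<open>L2_opnorm\<close> is meaningful only if some bound exists. For differences such as
  \<open>q(A) - B\<close>, a bound has to be established before their operator norm can be used.
\<close>
definition L2_has_bound :: "'a measure \<Rightarrow> 'a fun_op \<Rightarrow> real \<Rightarrow> bool" where
  "L2_has_bound M A c \<longleftrightarrow> 0 \<le> c \<and> (\<forall>f\<in>L2 M. A f \<in> L2 M \<and> L2_norm M (A f) \<le> c * L2_norm M f)"

lemma L2_has_boundD:
  assumes "L2_has_bound M A c"
  shows "0 \<le> c" "f \<in> L2 M \<Longrightarrow> A f \<in> L2 M" "f \<in> L2 M \<Longrightarrow> L2_norm M (A f) \<le> c * L2_norm M f"
  using assms by (auto simp: L2_has_bound_def)

lemma L2_bounded_has_bound:
  assumes "L2_bounded M A" obtains c where "L2_has_bound M A c"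
proof -
  obtain C where C: "\<And>f. f \<in> L2 M \<Longrightarrow> L2_norm M (A f) \<le> C * L2_norm M f"
    using assms unfolding L2_bounded_def by blast
  have "L2_norm M (A f) \<le> max C 0 * L2_norm M f" if "f \<in> L2 M" for f
    by (rule order_trans[OF C[OF that]]) (auto intro: mult_right_mono L2_norm_nonneg)
  then have "L2_has_bound M A (max C 0)"
    using assms by (auto simp: L2_has_bound_def L2_bounded_def)
  then show thesis by (rule that)
qed

lemma L2_has_bound_diff:
  assumes A: "L2_has_bound M A c" and B: "L2_has_bound M B d"
  shows "L2_has_bound M (\<lambda>f x. A f x - B f x) (2 * (c + d))"
  unfolding L2_has_bound_def
proof (intro conjI ballI)
  note c = L2_has_boundD(1)[OF A] and d = L2_has_boundD(1)[OF B]
  show "0 \<le> 2 * (c + d)" using c d by simp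
  fix f assume f: "f \<in> L2 M"
  note L = L2_diff[OF L2_has_boundD(2)[OF A f] L2_has_boundD(2)[OF B f]]
  show "(\<lambda>x. A f x - B f x) \<in> L2 M" by (rule L(1))
  let ?n = "L2_norm M f"
  have sq: "(L2_norm M (A f))\<^sup>2 \<le> (c * ?n)\<^sup>2" "(L2_norm M (B f))\<^sup>2 \<le> (d * ?n)\<^sup>2"
    by (intro power_mono L2_norm_nonneg L2_has_boundD(3)[OF A f] L2_has_boundD(3)[OF B f])+
  have "0 \<le> c * ?n * (d * ?n)" using c d L2_norm_nonneg[of M f] by simp
  then have "2 * (c * ?n)\<^sup>2 + 2 * (d * ?n)\<^sup>2 \<le> (2 * (c * ?n + d * ?n))\<^sup>2"
    by (simp add: power2_sum power_mult_distrib[of 2])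
  then have "(L2_norm M (\<lambda>x. A f x - B f x))\<^sup>2 \<le> (2 * (c + d) * ?n)\<^sup>2"
    using L(2) sq by (simp add: algebra_simps)
  then show "L2_norm M (\<lambda>x. A f x - B f x) \<le> 2 * (c + d) * ?n"
    by (rule power2_le_imp_le) (use c d L2_norm_nonneg[of M f] in simp)
qed

lemma L2_opnorm_le:
  assumes "L2_has_bound M A c" shows "L2_opnorm M A \<le> c"
  unfolding L2_opnorm_def
  by (rule cInf_lower) (use assms in \<open>auto simp: L2_has_bound_def intro!: bdd_belowI[of _ 0]\<close>)

lemma L2_opnorm_nonneg:
  assumes "L2_has_bound M A c" shows "0 \<le> L2_opnorm M A"
  unfolding L2_opnorm_def
  by (rule cInf_greatest) (use assms in \<open>auto simp: L2_has_bound_def\<close>)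

lemma L2_norm_le_opnorm:
  assumes A: "L2_has_bound M A c" and f: "f \<in> L2 M"
  shows "L2_norm M (A f) \<le> L2_opnorm M A * L2_norm M f"
proof (cases "L2_norm M f = 0")
  case True
  then show ?thesis using L2_has_boundD(3)[OF A f] by simp
next
  case False
  then have pos: "0 < L2_norm M f" using L2_norm_nonneg[of M f] by simp
  have "L2_norm M (A f) / L2_norm M f \<le> L2_opnorm M A"
    unfolding L2_opnorm_def
    by (rule cInf_greatest) (use A f pos in \<open>auto simp: L2_has_bound_def field_simps\<close>)
  then show ?thesis using pos by (simp add: field_simps)
qed

text \<open>
  The powers \<open>L2_op_powr\<close> are characterized by what happens along all such sequences; the
  characterization determines them only because there is at least one, by the theorem of Weierstrass.
\<close>
lemma ex_poly_uniform_limit_powr: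
  assumes "0 < p"
  shows "\<exists>q :: nat \<Rightarrow> real poly. uniform_limit {0..N} (\<lambda>n t. poly (q n) t) (\<lambda>t. t powr p) sequentially"
proof -
  have cont: "continuous_on {0..N} (\<lambda>t. t powr p)"
    using assms by (intro continuous_on_powr' continuous_intros) auto
  have "\<exists>q. \<forall>t\<in>{0..N}. \<bar>t powr p - poly q t\<bar> < 1 / real (Suc n)" for n
  proof -
    have "0 < 1 / real (Suc n)" by simp
    from Stone_Weierstrass_real_polynomial_function[OF compact_Icc cont this]
    obtain g where g: "real_polynomial_function g" "\<And>t. t \<in> {0..N} \<Longrightarrow> \<bar>t powr p - g t\<bar> < 1 / real (Suc n)"
      by blast
    obtain c m where cm: "g = (\<lambda>t. \<Sum>i\<le>m. c i * t ^ i)"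
      using g(1) by (auto simp: real_polynomial_function_iff_sum)
    have "poly (\<Sum>i\<le>m. monom (c i) i) t = g t" for t
      by (simp add: cm poly_sum poly_monom)
    then show ?thesis using g(2) by (intro exI[of _ "\<Sum>i\<le>m. monom (c i) i"]) auto
  qed
  then obtain q where q: "\<And>n t. t \<in> {0..N} \<Longrightarrow> \<bar>t powr p - poly (q n) t\<bar> < 1 / real (Suc n)"
    by metis
  have "uniform_limit {0..N} (\<lambda>n t. poly (q n) t) (\<lambda>t. t powr p) sequentially"
  proof (rule uniform_limitI)
    fix e :: real assume "0 < e"
    then have "\<forall>\<^sub>F n in sequentially. 1 / real (Suc n) < e"
      by (rule order_tendstoD(2)[OF LIMSEQ_Suc[OF lim_1_over_n]])
    then show "\<forall>\<^sub>F n in sequentially. \<forall>t\<in>{0..N}. dist (poly (q n) t) (t powr p) < e"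
    proof eventually_elim
      case (elim n)
      show ?case using elim q[of _ n] by (fastforce simp: dist_real_def abs_minus_commute)
    qed
  qed
  then show ?thesis by blast
qed

context sigma_finite_subalgebra
begin

section \<open>Conditional expectation on its domain\<close>

abbreviation E :: "('a \<Rightarrow> complex) \<Rightarrow> 'a \<Rightarrow> complex" where
  "E \<equiv> complex_cond_exp M F"

abbreviation Esq :: "('a \<Rightarrow> complex) \<Rightarrow> 'a \<Rightarrow> ennreal" where
  "Esq \<equiv> cond_exp_sq M F"

abbreviation dom_E :: "('a \<Rightarrow> complex) set" where
  "dom_E \<equiv> cond_exp_dom M F"

lemma F_imp_M: "f \<in> measurable F N \<Longrightarrow> f \<in> measurable M N"
  using measurable_from_subalg[OF subalg] .

lemma sets_F_imp_M: "A \<in> sets F \<Longrightarrow> A \<in> sets M"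
  using subalg by (auto simp: subalgebra_def)

lemma E_conv: "E g x = complex_of_real (real_cond_exp M F (\<lambda>y. Re (g y)) x) +
    \<i> * complex_of_real (real_cond_exp M F (\<lambda>y. Im (g y)) x)"
  by (simp add: complex_cond_exp_def complex_eq_iff)

lemma Re_E: "Re (E g x) = real_cond_exp M F (\<lambda>y. Re (g y)) x"
  and Im_E: "Im (E g x) = real_cond_exp M F (\<lambda>y. Im (g y)) x"
  by (simp_all add: complex_cond_exp_def)

lemma E_measurable_F [measurable]: "E g \<in> borel_measurable F"
  unfolding E_conv[abs_def] by measurable

lemma E_measurable [measurable]: "E g \<in> borel_measurable M"
  by (rule F_imp_M[OF E_measurable_F])

lemma Esq_measurable_F [measurable]: "Esq g \<in> borel_measurable F"
  unfolding cond_exp_sq_def by measurable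

lemma Esq_measurable [measurable]: "Esq g \<in> borel_measurable M"
  unfolding cond_exp_sq_def by measurable

lemma dom_E_measurable: "g \<in> dom_E \<Longrightarrow> g \<in> borel_measurable M"
  by (simp add: cond_exp_dom_def)

lemma E_cong:
  assumes "AE x in M. f x = g x" and [measurable]: "f \<in> borel_measurable M" "g \<in> borel_measurable M"
  shows "AE x in M. E f x = E g x"
proof -
  have "AE x in M. Re (f x) = Re (g x)" "AE x in M. Im (f x) = Im (g x)"
    using assms(1) by auto
  then have "AE x in M. real_cond_exp M F (\<lambda>y. Re (f y)) x = real_cond_exp M F (\<lambda>y. Re (g y)) x"
    "AE x in M. real_cond_exp M F (\<lambda>y. Im (f y)) x = real_cond_exp M F (\<lambda>y. Im (g y)) x"
    by (intro real_cond_exp_cong; simp)+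
  then show ?thesis by eventually_elim (simp add: E_conv)
qed

lemma real_cond_exp_uminus: "real_cond_exp M F (\<lambda>x. - f x) x = - real_cond_exp M F f x"
  by (simp add: real_cond_exp_def)

lemma E_cnj: "E (\<lambda>x. cnj (g x)) x = cnj (E g x)"
  by (simp add: complex_cond_exp_def real_cond_exp_uminus complex_eq_iff)

text \<open>
  For \<open>\<phi> = E(|g|)\<close> the function \<open>g\<close> is integrable on the sets \<open>A\<close> below, so that facts about
  integrable functions extend to the domain of \<open>E\<close>.
\<close>
lemma AE_localize:
  fixes \<phi> :: "'a \<Rightarrow> ennreal"
  assumes [measurable]: "\<phi> \<in> borel_measurable F"
    and fin: "AE x in M. \<phi> x < \<infinity>"
    and loc: "\<And>A n. A \<in> sets F \<Longrightarrow> emeasure M A < \<infinity> \<Longrightarrow> (\<And>x. x \<in> A \<Longrightarrow> \<phi> x \<le> of_nat n) \<Longrightarrow>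
       AE x in M. x \<in> A \<longrightarrow> P x"
  shows "AE x in M. P x"
proof -
  interpret R: sigma_finite_measure "restr_to_subalg M F" by (rule sigma_fin_subalg)
  obtain B :: "nat \<Rightarrow> 'a set" where B: "range B \<subseteq> sets (restr_to_subalg M F)"
    "(\<Union>i. B i) = space (restr_to_subalg M F)" "\<And>i. emeasure (restr_to_subalg M F) (B i) \<noteq> \<infinity>"
    by (metis R.sigma_finite)
  have B_F: "B i \<in> sets F" for i
    using B(1) sets_restr_to_subalg[OF subalg] by auto
  have B_fin: "emeasure M (B i) < \<infinity>" for i
    using B(3)[of i] emeasure_restr_to_subalg[OF subalg B_F] by (simp add: less_top)
  define A where "A i n = B i \<inter> {x \<in> space F. \<phi> x \<le> of_nat n}" for i n
  have A_F: "A i n \<in> sets F" for i n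
    unfolding A_def using B_F by measurable
  have "AE x in M. x \<in> A i n \<longrightarrow> P x" for i n
  proof (rule loc[OF A_F])
    have "emeasure M (A i n) \<le> emeasure M (B i)"
      by (rule emeasure_mono) (auto simp: A_def intro: sets_F_imp_M[OF B_F])
    then show "emeasure M (A i n) < \<infinity>" using B_fin[of i] by auto
  qed (auto simp: A_def)
  then have "AE x in M. \<forall>i n. x \<in> A i n \<longrightarrow> P x"
    unfolding AE_all_countable by blast
  with fin AE_space show ?thesis
  proof eventually_elim
    case (elim x)
    obtain n where n: "\<phi> x < of_nat n" using elim(1) ennreal_Ex_less_of_nat by auto
    obtain i where "x \<in> B i"
      using elim(2) B(2) space_restr_to_subalg[of M F] by auto
    then have "x \<in> A i n"
      using n elim(2) subalg by (auto simp: A_def subalgebra_def)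
    then show ?case using elim(3) by auto
  qed
qed

lemma integrable_localized:
  fixes g :: "'a \<Rightarrow> complex"
  assumes [measurable]: "g \<in> borel_measurable M" "A \<in> sets F" and fin: "emeasure M A < \<infinity>"
    and le: "\<And>x. x \<in> A \<Longrightarrow> nn_cond_exp M F (\<lambda>y. ennreal (cmod (g y))) x \<le> of_nat n"
  shows "integrable M (\<lambda>x. indicator A x * g x)"
proof (rule integrableI_bounded)
  note [measurable] = sets_F_imp_M[OF assms(2)]
  show "(\<lambda>x. indicator A x * g x) \<in> borel_measurable M" by measurable
  have "(\<integral>\<^sup>+x. ennreal (norm (indicator A x * g x)) \<partial>M)
      = (\<integral>\<^sup>+x. indicator A x * ennreal (cmod (g x)) \<partial>M)"
    by (intro nn_integral_cong) (auto simp: indicator_def)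
  also have "\<dots> = (\<integral>\<^sup>+x. indicator A x * nn_cond_exp M F (\<lambda>y. ennreal (cmod (g y))) x \<partial>M)"
    by (rule nn_cond_exp_intg[symmetric]) measurable
  also have "\<dots> \<le> (\<integral>\<^sup>+x. of_nat n * indicator A x \<partial>M)"
    by (intro nn_integral_mono) (auto simp: indicator_def le)
  also have "\<dots> = of_nat n * emeasure M A" by (simp add: nn_integral_cmult_indicator)
  also have "\<dots> < \<infinity>" using fin by (simp add: ennreal_mult_less_top of_nat_less_top)
  finally show "(\<integral>\<^sup>+x. ennreal (norm (indicator A x * g x)) \<partial>M) < \<infinity>" .
qed

lemma E_mult_integrable:
  assumes [measurable]: "f \<in> borel_measurable F" "g \<in> borel_measurable M"
    and int: "integrable M (\<lambda>x. f x * g x)"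
  shows "AE x in M. E (\<lambda>y. f y * g y) x = f x * E g x"
proof -
  note [measurable] = F_imp_M[OF assms(1)]
  have *: "integrable M (\<lambda>x. Re (f x) * Re (g x))" "integrable M (\<lambda>x. Im (f x) * Im (g x))"
     "integrable M (\<lambda>x. Re (f x) * Im (g x))" "integrable M (\<lambda>x. Im (f x) * Re (g x))"
    by (rule Bochner_Integration.integrable_bound[OF int]; force simp: norm_mult abs_mult
        intro!: mult_mono abs_Re_le_cmod abs_Im_le_cmod)+
  have "AE x in M. real_cond_exp M F (\<lambda>x. Re (f x) * Re (g x)) x = Re (f x) * real_cond_exp M F (\<lambda>x. Re (g x)) x"
    "AE x in M. real_cond_exp M F (\<lambda>x. Im (f x) * Im (g x)) x = Im (f x) * real_cond_exp M F (\<lambda>x. Im (g x)) x"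
    "AE x in M. real_cond_exp M F (\<lambda>x. Re (f x) * Im (g x)) x = Re (f x) * real_cond_exp M F (\<lambda>x. Im (g x)) x"
    "AE x in M. real_cond_exp M F (\<lambda>x. Im (f x) * Re (g x)) x = Im (f x) * real_cond_exp M F (\<lambda>x. Re (g x)) x"
    by (intro real_cond_exp_mult *; measurable)+
  moreover note real_cond_exp_diff[OF *(1,2)] real_cond_exp_add[OF *(3,4)]
  ultimately show ?thesis
    by eventually_elim (simp add: complex_cond_exp_def complex_eq_iff)
qed

lemma E_add_integrable:
  assumes int: "integrable M f" "integrable M g"
  shows "AE x in M. E (\<lambda>y. f y + g y) x = E f x + E g x"
proof -
  have "AE x in M. real_cond_exp M F (\<lambda>x. Re (f x) + Re (g x)) x =
          real_cond_exp M F (\<lambda>x. Re (f x)) x + real_cond_exp M F (\<lambda>x. Re (g x)) x"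
    "AE x in M. real_cond_exp M F (\<lambda>x. Im (f x) + Im (g x)) x =
          real_cond_exp M F (\<lambda>x. Im (f x)) x + real_cond_exp M F (\<lambda>x. Im (g x)) x"
    using int by (auto intro!: real_cond_exp_add)
  then show ?thesis
    by eventually_elim (simp add: complex_cond_exp_def complex_eq_iff)
qed

lemma E_integral:
  assumes int: "integrable M g"
  shows "integrable M (E g)" "(\<integral>x. E g x \<partial>M) = (\<integral>x. g x \<partial>M)"
proof -
  have i: "integrable M (\<lambda>x. Re (g x))" "integrable M (\<lambda>x. Im (g x))"
    using int by auto
  note r = real_cond_exp_int[OF i(1)] and m = real_cond_exp_int[OF i(2)]
  show "integrable M (E g)"
    unfolding E_conv[abs_def] using r(1) m(1) by auto
  then have "Re (\<integral>x. E g x \<partial>M) = (\<integral>x. Re (g x) \<partial>M)" "Im (\<integral>x. E g x \<partial>M) = (\<integral>x. Im (g x) \<partial>M)"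
    using r(2) m(2) integral_Re[OF \<open>integrable M (E g)\<close>] integral_Im[OF \<open>integrable M (E g)\<close>]
    by (simp_all add: Re_E Im_E)
  then show "(\<integral>x. E g x \<partial>M) = (\<integral>x. g x \<partial>M)"
    using int by (simp add: complex_eq_iff)
qed

lemma E_localized:
  assumes [measurable]: "g \<in> borel_measurable M" "A \<in> sets F"
    and "integrable M (\<lambda>x. indicator A x * g x)"
  shows "AE x in M. x \<in> A \<longrightarrow> E (\<lambda>y. indicator A y * g y) x = E g x"
proof -
  have "AE x in M. E (\<lambda>y. indicator A y * g y) x = indicator A x * E g x"
    by (rule E_mult_integrable) (use assms in measurable)
  then show ?thesis by eventually_elim auto
qed

lemma dom_E_mult:
  assumes g: "g \<in> dom_E" and [measurable]: "f \<in> borel_measurable F"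
  shows "(\<lambda>x. f x * g x) \<in> dom_E"
proof -
  note [measurable] = dom_E_measurable[OF g] F_imp_M[OF assms(2)]
  have "AE x in M. ennreal (cmod (f x)) * nn_cond_exp M F (\<lambda>y. ennreal (cmod (g y))) x
       = nn_cond_exp M F (\<lambda>y. ennreal (cmod (f y)) * ennreal (cmod (g y))) x"
    by (rule nn_cond_exp_prod) measurable
  moreover have "AE x in M. nn_cond_exp M F (\<lambda>y. ennreal (cmod (g y))) x < \<infinity>"
    using g by (simp add: cond_exp_dom_def)
  ultimately have "AE x in M. nn_cond_exp M F (\<lambda>y. ennreal (cmod (f y * g y))) x < \<infinity>"
    by eventually_elim (simp add: norm_mult ennreal_mult flip: ennreal_mult_less_top,
        metis ennreal_mult_less_top ennreal_less_top)
  then show ?thesis by (simp add: cond_exp_dom_def)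
qed

lemma dom_E_add:
  assumes f: "f \<in> dom_E" and g: "g \<in> dom_E"
  shows "(\<lambda>x. f x + g x) \<in> dom_E"
proof -
  note [measurable] = dom_E_measurable[OF g] dom_E_measurable[OF f]
  have "AE x in M. nn_cond_exp M F (\<lambda>y. ennreal (cmod (f y))) x + nn_cond_exp M F (\<lambda>y. ennreal (cmod (g y))) x
       = nn_cond_exp M F (\<lambda>y. ennreal (cmod (f y)) + ennreal (cmod (g y))) x"
    by (rule nn_cond_exp_sum) measurable
  moreover have "AE x in M. nn_cond_exp M F (\<lambda>y. ennreal (cmod (f y + g y))) x \<le>
      nn_cond_exp M F (\<lambda>y. ennreal (cmod (f y)) + ennreal (cmod (g y))) x"
    by (rule nn_cond_exp_mono) (auto simp: norm_triangle_ineq simp flip: ennreal_plus)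
  moreover have "AE x in M. nn_cond_exp M F (\<lambda>y. ennreal (cmod (g y))) x < \<infinity>"
     "AE x in M. nn_cond_exp M F (\<lambda>y. ennreal (cmod (f y))) x < \<infinity>"
    using f g by (simp_all add: cond_exp_dom_def)
  ultimately have "AE x in M. nn_cond_exp M F (\<lambda>y. ennreal (cmod (f y + g y))) x < \<infinity>"
    by eventually_elim (metis ennreal_add_less_top infinity_ennreal_def le_less_trans)
  then show ?thesis by (simp add: cond_exp_dom_def)
qed

text \<open>
  Neither \<open>g\<close> nor \<open>f g\<close> need be integrable, but \<open>f g\<close> is integrable on sets of \<open>F\<close> of finite measure
  where \<open>E(|f g|)\<close> is bounded.
\<close>
lemma E_mult:
  assumes [measurable]: "f \<in> borel_measurable F" and g: "g \<in> dom_E"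
  shows "AE x in M. E (\<lambda>y. f y * g y) x = f x * E g x"
proof -
  note [measurable] = dom_E_measurable[OF g] F_imp_M[OF assms(1)]
  define \<phi> where "\<phi> x = nn_cond_exp M F (\<lambda>y. ennreal (cmod (f y * g y))) x" for x
  have [measurable]: "\<phi> \<in> borel_measurable F" unfolding \<phi>_def by measurable
  show ?thesis
  proof (rule AE_localize[where \<phi> = \<phi>])
    show "AE x in M. \<phi> x < \<infinity>"
      using dom_E_mult[OF g assms(1)] by (simp add: cond_exp_dom_def \<phi>_def)
    fix A n assume [measurable]: "A \<in> sets F" and A: "emeasure M A < \<infinity>" "\<And>x. x \<in> A \<Longrightarrow> \<phi> x \<le> of_nat n"
    have int: "integrable M (\<lambda>x. indicator A x * (f x * g x))"
      by (rule integrable_localized[where n = n]) (use A in \<open>auto simp: \<phi>_def\<close>)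
    have "AE x in M. x \<in> A \<longrightarrow> E (\<lambda>y. indicator A y * (f y * g y)) x = E (\<lambda>y. f y * g y) x"
      by (rule E_localized[OF _ _ int]) measurable
    moreover have "AE x in M. E (\<lambda>y. (indicator A y * f y) * g y) x = (indicator A x * f x) * E g x"
      by (rule E_mult_integrable) (use int in \<open>simp_all add: mult.assoc\<close>)
    ultimately show "AE x in M. x \<in> A \<longrightarrow> E (\<lambda>y. f y * g y) x = f x * E g x"
      by eventually_elim (auto simp: mult.assoc)
  qed simp
qed

lemma E_add:
  assumes f: "f \<in> dom_E" and g: "g \<in> dom_E"
  shows "AE x in M. E (\<lambda>y. f y + g y) x = E f x + E g x"
proof -
  note [measurable] = dom_E_measurable[OF g] dom_E_measurable[OF f]
  define \<phi> where "\<phi> x = nn_cond_exp M F (\<lambda>y. ennreal (cmod (f y))) x +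
    nn_cond_exp M F (\<lambda>y. ennreal (cmod (g y))) x" for x
  have [measurable]: "\<phi> \<in> borel_measurable F" unfolding \<phi>_def by measurable
  show ?thesis
  proof (rule AE_localize[where \<phi> = \<phi>])
    have "AE x in M. nn_cond_exp M F (\<lambda>y. ennreal (cmod (g y))) x < \<infinity>"
     "AE x in M. nn_cond_exp M F (\<lambda>y. ennreal (cmod (f y))) x < \<infinity>"
      using f g by (simp_all add: cond_exp_dom_def)
    then show "AE x in M. \<phi> x < \<infinity>"
      unfolding \<phi>_def by eventually_elim (simp add: ennreal_add_less_top)
    fix A n assume [measurable]: "A \<in> sets F" and A: "emeasure M A < \<infinity>" "\<And>x. x \<in> A \<Longrightarrow> \<phi> x \<le> of_nat n"
    have le: "nn_cond_exp M F (\<lambda>y. ennreal (cmod (f y))) x \<le> of_nat n"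
       "nn_cond_exp M F (\<lambda>y. ennreal (cmod (g y))) x \<le> of_nat n" if "x \<in> A" for x
      using A(2)[OF that] unfolding \<phi>_def by (auto intro: order_trans[rotated])
    have int: "integrable M (\<lambda>x. indicator A x * f x)" "integrable M (\<lambda>x. indicator A x * g x)"
      by (rule integrable_localized[where n = n]; use A le in auto)+
    have int_add: "integrable M (\<lambda>x. indicator A x * (f x + g x))"
      using Bochner_Integration.integrable_add[OF int] by (simp add: distrib_left)
    have "AE x in M. x \<in> A \<longrightarrow> E (\<lambda>y. indicator A y * f y) x = E f x"
      "AE x in M. x \<in> A \<longrightarrow> E (\<lambda>y. indicator A y * g y) x = E g x"
      "AE x in M. x \<in> A \<longrightarrow> E (\<lambda>y. indicator A y * (f y + g y)) x = E (\<lambda>y. f y + g y) x"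
      by (rule E_localized[OF _ _ int(1)] E_localized[OF _ _ int(2)] E_localized[OF _ _ int_add]; measurable)+
    moreover note E_add_integrable[OF int]
    ultimately show "AE x in M. x \<in> A \<longrightarrow> E (\<lambda>y. f y + g y) x = E f x + E g x"
      by eventually_elim (auto simp: distrib_left)
  qed simp
qed

lemma E_of_nonneg:
  assumes [measurable]: "g \<in> borel_measurable M" and nn: "\<And>x. 0 \<le> g x"
  shows "AE x in M. E (\<lambda>y. complex_of_real (g y)) x = complex_of_real (enn2real (nn_cond_exp M F (\<lambda>y. ennreal (g y)) x))"
proof -
  have "AE x in M. 0 = nn_cond_exp M F (\<lambda>y. 0) x"
    by (rule nn_cond_exp_F_meas) measurable
  then show ?thesis
    by eventually_elim (use nn in \<open>simp add: E_conv real_cond_exp_def ennreal_neg\<close>)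
qed

section \<open>Conditional square-integrability and the Cauchy-Schwarz inequality\<close>

text \<open>
  This class contains \<open>L\<^sup>2\<close> and, in contrast to it, is closed under multiplication by arbitrary
  \<open>F\<close>-measurable functions. Products of two of its members lie in the domain of \<open>E\<close>.
\<close>
definition cond_L2 :: "('a \<Rightarrow> complex) set" where
  "cond_L2 = {u \<in> borel_measurable M. AE x in M. Esq u x < \<infinity>}"

abbreviation wEu :: "('a \<Rightarrow> complex) \<Rightarrow> ('a \<Rightarrow> complex) \<Rightarrow> ('a \<Rightarrow> complex) \<Rightarrow> 'a \<Rightarrow> complex" where
  "wEu \<equiv> weighted_cond_op M F"

lemma cond_L2_measurable: "u \<in> cond_L2 \<Longrightarrow> u \<in> borel_measurable M"
  by (simp add: cond_L2_def)

lemma cond_L2_finite: "u \<in> cond_L2 \<Longrightarrow> AE x in M. Esq u x < \<infinity>"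
  by (simp add: cond_L2_def)

lemma nn_integral_Esq:
  assumes "f \<in> borel_measurable F" "g \<in> borel_measurable M"
  shows "(\<integral>\<^sup>+x. f x * Esq g x \<partial>M) = (\<integral>\<^sup>+x. f x * ennreal ((cmod (g x))\<^sup>2) \<partial>M)"
  unfolding cond_exp_sq_def by (rule nn_cond_exp_intg) (use assms in measurable)

lemma Esq_mult:
  assumes [measurable]: "m \<in> borel_measurable F" "u \<in> borel_measurable M"
  shows "AE x in M. Esq (\<lambda>y. m y * u y) x = ennreal ((cmod (m x))\<^sup>2) * Esq u x"
proof -
  note [measurable] = F_imp_M[OF assms(1)]
  have "AE x in M. ennreal ((cmod (m x))\<^sup>2) * nn_cond_exp M F (\<lambda>y. ennreal ((cmod (u y))\<^sup>2)) x
    = nn_cond_exp M F (\<lambda>y. ennreal ((cmod (m y))\<^sup>2) * ennreal ((cmod (u y))\<^sup>2)) x"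
    by (rule nn_cond_exp_prod) measurable
  then show ?thesis
    by eventually_elim (simp add: cond_exp_sq_def norm_mult power_mult_distrib ennreal_mult)
qed

lemma Esq_cnj [simp]: "Esq (\<lambda>x. cnj (u x)) = Esq u"
  by (simp add: cond_exp_sq_def)

lemma cond_L2_cnj: "u \<in> cond_L2 \<Longrightarrow> (\<lambda>x. cnj (u x)) \<in> cond_L2"
  unfolding cond_L2_def by (auto intro: borel_measurable_cnj)

lemma cond_L2_mult:
  assumes m: "m \<in> borel_measurable F" and u: "u \<in> cond_L2"
  shows "(\<lambda>x. m x * u x) \<in> cond_L2"
proof -
  note [measurable] = F_imp_M[OF m] cond_L2_measurable[OF u]
  have "AE x in M. Esq (\<lambda>x. m x * u x) x < \<infinity>"
    using Esq_mult[OF m cond_L2_measurable[OF u]] cond_L2_finite[OF u]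
    by eventually_elim (simp add: ennreal_mult_less_top)
  then show ?thesis by (simp add: cond_L2_def)
qed

lemma L2_imp_cond_L2:
  assumes "f \<in> L2 M" shows "f \<in> cond_L2"
proof -
  have [measurable]: "f \<in> borel_measurable M" using L2_measurable[OF assms] .
  have "(\<integral>\<^sup>+x. Esq f x \<partial>M) = (\<integral>\<^sup>+x. ennreal ((cmod (f x))\<^sup>2) \<partial>M)"
    using nn_integral_Esq[of "\<lambda>_. 1" f] by simp
  also have "\<dots> < \<infinity>" using assms by (simp add: L2_iff)
  finally have "AE x in M. Esq f x \<noteq> \<infinity>" by (intro nn_integral_noteq_infinite) auto
  then show ?thesis by (simp add: cond_L2_def less_top)
qed

text \<open>
  \<open>|u f| \<le> |u|\<^sup>2 + |f|\<^sup>2\<close>.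
\<close>
lemma mult_in_dom_E:
  assumes "u \<in> cond_L2" "f \<in> cond_L2"
  shows "(\<lambda>x. u x * f x) \<in> dom_E"
proof -
  note [measurable] = cond_L2_measurable[OF assms(1)] cond_L2_measurable[OF assms(2)]
  let ?e = "\<lambda>u y. ennreal ((cmod (u y))\<^sup>2)"
  have "AE x in M. nn_cond_exp M F (?e u) x + nn_cond_exp M F (?e f) x = nn_cond_exp M F (\<lambda>y. ?e u y + ?e f y) x"
    by (rule nn_cond_exp_sum) measurable
  moreover have "AE x in M. nn_cond_exp M F (\<lambda>y. ennreal (cmod (u y * f y))) x \<le> nn_cond_exp M F (\<lambda>y. ?e u y + ?e f y) x"
  proof (rule nn_cond_exp_mono)
    have "ennreal (cmod (u x * f x)) \<le> ennreal ((cmod (u x))\<^sup>2 + (cmod (f x))\<^sup>2)" for x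
      by (intro ennreal_leI cmod_mult_le_squares)
    then show "AE x in M. ennreal (cmod (u x * f x)) \<le> ?e u x + ?e f x"
      by (simp add: ennreal_plus)
  qed measurable
  moreover note cond_L2_finite[OF assms(1)] cond_L2_finite[OF assms(2)]
  ultimately have "AE x in M. nn_cond_exp M F (\<lambda>y. ennreal (cmod (u y * f y))) x < \<infinity>"
  proof eventually_elim
    case (elim x)
    have "nn_cond_exp M F (\<lambda>y. ennreal (cmod (u y * f y))) x \<le> Esq u x + Esq f x"
      using elim(1,2) by (simp add: cond_exp_sq_def)
    also have "\<dots> < \<infinity>" using elim(3,4) by simp
    finally show ?case .
  qed
  then show ?thesis by (simp add: cond_exp_dom_def)
qed

lemma E_mult_cnj_self:
  assumes [measurable]: "u \<in> borel_measurable M"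
  shows "AE x in M. E (\<lambda>y. u y * cnj (u y)) x = complex_of_real (enn2real (Esq u x))"
  using E_of_nonneg[of "\<lambda>x. (cmod (u x))\<^sup>2"]
  by (simp add: cond_exp_sq_def complex_norm_square del: of_real_power)

text \<open>
  Expand \<open>0 \<le> E(|f - c cnj u|\<^sup>2)\<close> for \<open>F\<close>-measurable \<open>c\<close>. The optimal choice is
  \<open>c = E(u f) / E(|u|\<^sup>2)\<close>; adding \<open>1/(n+1)\<close> to the denominator and letting \<open>n\<close> tend to infinity covers
  the points where \<open>E(|u|\<^sup>2)\<close> vanishes as well.
\<close>
lemma cond_Cauchy_Schwarz:
  assumes u: "u \<in> cond_L2" and f: "f \<in> cond_L2"
  shows "AE x in M. ennreal ((cmod (E (\<lambda>y. u y * f y) x))\<^sup>2) \<le> Esq u x * Esq f x"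
proof -
  note [measurable] = cond_L2_measurable[OF u] cond_L2_measurable[OF f]
  define e where "e = E (\<lambda>y. u y * f y)"
  define \<alpha> where "\<alpha> x = enn2real (Esq u x)" for x
  define \<beta> where "\<beta> x = enn2real (Esq f x)" for x
  have [measurable]: "e \<in> borel_measurable F" "\<alpha> \<in> borel_measurable F" "\<beta> \<in> borel_measurable F"
    unfolding e_def \<alpha>_def \<beta>_def by measurable
  have uf: "(\<lambda>y. u y * f y) \<in> dom_E" and uf': "(\<lambda>y. cnj (u y) * cnj (f y)) \<in> dom_E"
    by (intro mult_in_dom_E u f cond_L2_cnj)+
  have uu: "(\<lambda>y. u y * cnj (u y)) \<in> dom_E" and ff: "(\<lambda>y. f y * cnj (f y)) \<in> dom_E"
    by (intro mult_in_dom_E u f cond_L2_cnj)+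
  have est: "AE x in M. (cmod (e x))\<^sup>2 \<le> (\<alpha> x + 1 / real (Suc n)) * \<beta> x" for n
  proof -
    \<comment> \<open>the regularized coefficient of the projection of \<open>f\<close> to the multiples of \<open>cnj u\<close>\<close>
    define c where "c x = e x / complex_of_real (\<alpha> x + 1 / real (Suc n))" for x
    have [measurable]: "c \<in> borel_measurable F" unfolding c_def by measurable
    have [measurable]: "c \<in> borel_measurable M" by (rule F_imp_M) simp
    define g where "g x = f x - c x * cnj (u x)" for x
    have [measurable]: "g \<in> borel_measurable M" unfolding g_def by measurable
    have eq: "(\<lambda>y. g y * cnj (g y)) = (\<lambda>y. (f y * cnj (f y) + (- cnj (c y)) * (u y * f y))
       + ((- c y) * (cnj (u y) * cnj (f y)) + (c y * cnj (c y)) * (u y * cnj (u y))))"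
      by (simp add: g_def fun_eq_iff algebra_simps)
    have d: "(\<lambda>y. (- cnj (c y)) * (u y * f y)) \<in> dom_E"
      "(\<lambda>y. (- c y) * (cnj (u y) * cnj (f y))) \<in> dom_E"
      "(\<lambda>y. (c y * cnj (c y)) * (u y * cnj (u y))) \<in> dom_E"
      by (intro dom_E_mult uf uf' uu; measurable)+
    have "AE x in M. E (\<lambda>y. g y * cnj (g y)) x = E (\<lambda>y. f y * cnj (f y) + (- cnj (c y)) * (u y * f y)) x +
         E (\<lambda>y. (- c y) * (cnj (u y) * cnj (f y)) + (c y * cnj (c y)) * (u y * cnj (u y))) x"
      unfolding eq by (intro E_add dom_E_add d ff)
    moreover have "AE x in M. E (\<lambda>y. f y * cnj (f y) + (- cnj (c y)) * (u y * f y)) x =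
        E (\<lambda>y. f y * cnj (f y)) x + E (\<lambda>y. (- cnj (c y)) * (u y * f y)) x"
      by (intro E_add d ff)
    moreover have "AE x in M. E (\<lambda>y. (- c y) * (cnj (u y) * cnj (f y)) + (c y * cnj (c y)) * (u y * cnj (u y))) x =
        E (\<lambda>y. (- c y) * (cnj (u y) * cnj (f y))) x + E (\<lambda>y. (c y * cnj (c y)) * (u y * cnj (u y))) x"
      by (intro E_add d)
    moreover have "AE x in M. E (\<lambda>y. (- cnj (c y)) * (u y * f y)) x = - cnj (c x) * e x"
      unfolding e_def by (rule E_mult[OF _ uf]) measurable
    moreover have "AE x in M. E (\<lambda>y. (- c y) * (cnj (u y) * cnj (f y))) x = (- c x) * cnj (e x)"
      using E_mult[OF _ uf', of "\<lambda>x. - c x"] E_cnj[of "\<lambda>y. u y * f y"] by (simp add: e_def)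
    moreover have "AE x in M. E (\<lambda>y. (c y * cnj (c y)) * (u y * cnj (u y))) x = (c x * cnj (c x)) * E (\<lambda>y. u y * cnj (u y)) x"
      by (rule E_mult[OF _ uu]) measurable
    moreover have "AE x in M. E (\<lambda>y. u y * cnj (u y)) x = complex_of_real (\<alpha> x)"
      unfolding \<alpha>_def by (rule E_mult_cnj_self) measurable
    moreover have "AE x in M. E (\<lambda>y. f y * cnj (f y)) x = complex_of_real (\<beta> x)"
      unfolding \<beta>_def by (rule E_mult_cnj_self) measurable
    moreover have "AE x in M. E (\<lambda>y. g y * cnj (g y)) x = complex_of_real (enn2real (Esq g x))"
      by (rule E_mult_cnj_self) measurable
    ultimately show ?thesis
    proof eventually_elim
      case (elim x)
      define t where "t = \<alpha> x + 1 / real (Suc n)"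
      have \<alpha>0: "0 \<le> \<alpha> x" by (simp add: \<alpha>_def)
      have t: "t > \<alpha> x" "t > 0" using \<alpha>0 by (simp_all add: t_def add_nonneg_pos)
      have l: "c x = e x / complex_of_real t" by (simp add: c_def t_def)
      have ee: "e x * cnj (e x) = complex_of_real ((cmod (e x))\<^sup>2)"
        by (simp only: complex_norm_square)
      have ll: "c x * cnj (c x) = complex_of_real ((cmod (e x))\<^sup>2 / t\<^sup>2)"
        by (simp add: l ee power2_eq_square[of "complex_of_real t"])
      have le: "cnj (c x) * e x = complex_of_real ((cmod (e x))\<^sup>2 / t)" "c x * cnj (e x) = complex_of_real ((cmod (e x))\<^sup>2 / t)"
        by (simp_all add: l ee mult.commute[of "cnj (e x)"])
      have "complex_of_real (enn2real (Esq g x)) =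
         complex_of_real (\<beta> x) - cnj (c x) * e x + (- (c x * cnj (e x)) + c x * cnj (c x) * complex_of_real (\<alpha> x))"
        using elim by simp
      also have "\<dots> = complex_of_real (\<beta> x - (cmod (e x))\<^sup>2 / t + (- ((cmod (e x))\<^sup>2 / t) + (cmod (e x))\<^sup>2 / t\<^sup>2 * \<alpha> x))"
        unfolding ll le by simp
      finally have "enn2real (Esq g x) = \<beta> x - (cmod (e x))\<^sup>2 / t + (- ((cmod (e x))\<^sup>2 / t) + (cmod (e x))\<^sup>2 / t\<^sup>2 * \<alpha> x)"
        using of_real_eq_iff by blast
      then have "0 \<le> \<beta> x - (cmod (e x))\<^sup>2 / t + (- ((cmod (e x))\<^sup>2 / t) + (cmod (e x))\<^sup>2 / t\<^sup>2 * \<alpha> x)"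
        by (metis enn2real_nonneg)
      moreover have "(cmod (e x))\<^sup>2 / t\<^sup>2 * \<alpha> x \<le> (cmod (e x))\<^sup>2 / t\<^sup>2 * t"
        using t by (intro mult_left_mono) auto
      moreover have "(cmod (e x))\<^sup>2 / t\<^sup>2 * t = (cmod (e x))\<^sup>2 / t"
        using t by (simp add: power2_eq_square)
      ultimately have "(cmod (e x))\<^sup>2 / t \<le> \<beta> x" by linarith
      then have "(cmod (e x))\<^sup>2 \<le> t * \<beta> x" using t by (simp add: field_simps)
      then show ?case by (simp only: t_def)
    qed
  qed
  have "AE x in M. \<forall>n. (cmod (e x))\<^sup>2 \<le> (\<alpha> x + 1 / real (Suc n)) * \<beta> x"
    using est by (simp add: AE_all_countable)
  with cond_L2_finite[OF u] cond_L2_finite[OF f] show ?thesis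
  proof eventually_elim
    case (elim x)
    have "(\<lambda>n. (\<alpha> x + 1 / real (Suc n)) * \<beta> x) \<longlonglongrightarrow> (\<alpha> x + 0) * \<beta> x"
      by (intro tendsto_intros LIMSEQ_Suc[OF lim_1_over_n])
    then have "(cmod (e x))\<^sup>2 \<le> \<alpha> x * \<beta> x"
      using elim(3) LIMSEQ_le_const by (metis (no_types, lifting) add.right_neutral)
    then have "ennreal ((cmod (e x))\<^sup>2) \<le> ennreal (\<alpha> x) * ennreal (\<beta> x)"
      by (simp add: ennreal_leI \<alpha>_def \<beta>_def flip: ennreal_mult)
    then show ?case using elim(1,2) by (simp add: e_def \<alpha>_def \<beta>_def)
  qed
qed

section \<open>Bounded weighted conditional operators, adjoints and products\<close>

text \<open>
  Under this condition \<open>f \<mapsto> w E(u f)\<close> is a bounded operator on \<open>L\<^sup>2\<close> of norm at most \<open>K\<close>.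
\<close>
definition bounded_pair :: "('a \<Rightarrow> complex) \<Rightarrow> ('a \<Rightarrow> complex) \<Rightarrow> real \<Rightarrow> bool" where
  "bounded_pair w u K \<longleftrightarrow> w \<in> cond_L2 \<and> u \<in> cond_L2 \<and> 0 \<le> K \<and>
     (AE x in M. Esq w x * Esq u x \<le> ennreal (K\<^sup>2))"

lemma wEu_measurable:
  assumes [measurable]: "w \<in> borel_measurable M"
  shows "wEu w u f \<in> borel_measurable M"
  unfolding weighted_cond_op_def[abs_def] by measurable

lemma bounded_pair_cnj: "bounded_pair w u K \<Longrightarrow> bounded_pair (\<lambda>x. cnj (u x)) (\<lambda>x. cnj (w x)) K"
  by (simp add: bounded_pair_def cond_L2_cnj mult.commute)

text \<open>
  Since \<open>E(u f)\<close> is \<open>F\<close>-measurable, \<open>\<integral> |w E(u f)|\<^sup>2 = \<integral> E(|w|\<^sup>2) |E(u f)|\<^sup>2\<close>; then apply the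
  conditional Cauchy-Schwarz inequality.
\<close>
lemma wEu_bound:
  assumes wu: "bounded_pair w u K" and f: "f \<in> L2 M"
  shows "wEu w u f \<in> L2 M" "L2_norm M (wEu w u f) \<le> K * L2_norm M f"
proof -
  have w: "w \<in> cond_L2" and u: "u \<in> cond_L2" and K: "0 \<le> K"
    and le: "AE x in M. Esq w x * Esq u x \<le> ennreal (K\<^sup>2)"
    using wu by (auto simp: bounded_pair_def)
  note [measurable] = cond_L2_measurable[OF w] cond_L2_measurable[OF u] L2_measurable[OF f]
  let ?e = "E (\<lambda>y. u y * f y)"
  have "(\<integral>\<^sup>+x. ennreal ((cmod (wEu w u f x))\<^sup>2) \<partial>M) = (\<integral>\<^sup>+x. ennreal ((cmod (?e x))\<^sup>2) * ennreal ((cmod (w x))\<^sup>2) \<partial>M)"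
    by (intro nn_integral_cong) (simp add: weighted_cond_op_def norm_mult power_mult_distrib ennreal_mult mult.commute)
  also have "\<dots> = (\<integral>\<^sup>+x. ennreal ((cmod (?e x))\<^sup>2) * Esq w x \<partial>M)"
    by (rule nn_integral_Esq[symmetric]) measurable
  also have "\<dots> \<le> (\<integral>\<^sup>+x. ennreal (K\<^sup>2) * Esq f x \<partial>M)"
  proof (rule nn_integral_mono_AE)
    show "AE x in M. ennreal ((cmod (?e x))\<^sup>2) * Esq w x \<le> ennreal (K\<^sup>2) * Esq f x"
      using le cond_Cauchy_Schwarz[OF u L2_imp_cond_L2[OF f]]
    proof eventually_elim
      case (elim x)
      have "ennreal ((cmod (?e x))\<^sup>2) * Esq w x \<le> (Esq u x * Esq f x) * Esq w x"
        using elim(2) by (rule mult_right_mono) simp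
      also have "\<dots> = (Esq w x * Esq u x) * Esq f x" by (simp add: mult_ac)
      also have "\<dots> \<le> ennreal (K\<^sup>2) * Esq f x" using elim(1) by (rule mult_right_mono) simp
      finally show ?case .
    qed
  qed
  also have "\<dots> = (\<integral>\<^sup>+x. ennreal (K\<^sup>2) * ennreal ((cmod (f x))\<^sup>2) \<partial>M)"
    by (rule nn_integral_Esq) measurable
  also have "\<dots> = ennreal ((K * L2_norm M f)\<^sup>2)"
    by (simp add: nn_integral_cmult nn_integral_L2_norm[OF f] power_mult_distrib ennreal_mult)
  finally have *: "(\<integral>\<^sup>+x. ennreal ((cmod (wEu w u f x))\<^sup>2) \<partial>M) \<le> ennreal ((K * L2_norm M f)\<^sup>2)" .
  show "wEu w u f \<in> L2 M" "L2_norm M (wEu w u f) \<le> K * L2_norm M f"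
    by (rule L2_norm_le_nn_integral[OF _ _ *]; use K in \<open>simp add: wEu_measurable L2_norm_nonneg\<close>)+
qed

lemma E_mult_add_right:
  assumes "u \<in> cond_L2" "f \<in> cond_L2" "g \<in> cond_L2"
  shows "AE x in M. E (\<lambda>y. u y * (f y + g y)) x = E (\<lambda>y. u y * f y) x + E (\<lambda>y. u y * g y) x"
  unfolding distrib_left by (intro E_add mult_in_dom_E assms)

lemma E_mult_scale_right:
  assumes "u \<in> cond_L2" "f \<in> cond_L2" "m \<in> borel_measurable F"
  shows "AE x in M. E (\<lambda>y. u y * (m y * f y)) x = m x * E (\<lambda>y. u y * f y) x"
  using E_mult[OF assms(3) mult_in_dom_E[OF assms(1,2)]] by (simp add: mult.left_commute)

lemma wEu_L2_bounded:
  assumes wu: "bounded_pair w u K"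
  shows "L2_bounded M (wEu w u)"
proof (rule L2_boundedI[where C = K])
  have u: "u \<in> cond_L2" using wu by (simp add: bounded_pair_def)
  fix f g :: "'a \<Rightarrow> complex" and c :: complex assume f: "f \<in> L2 M"
  show "AE x in M. wEu w u (\<lambda>y. c * f y) x = c * wEu w u f x"
    using E_mult_scale_right[OF u L2_imp_cond_L2[OF f], of "\<lambda>_. c", OF borel_measurable_const]
    unfolding weighted_cond_op_def by eventually_elim (simp add: mult.left_commute)
  assume g: "g \<in> L2 M"
  show "AE x in M. wEu w u (\<lambda>y. f y + g y) x = wEu w u f x + wEu w u g x"
    using E_mult_add_right[OF u L2_imp_cond_L2[OF f] L2_imp_cond_L2[OF g]]
    unfolding weighted_cond_op_def by eventually_elim (simp add: distrib_left)
qed (auto intro: wEu_bound[OF wu])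

text \<open>
  Replace the integrand \<open>E(u f) w cnj g\<close> by its conditional expectation and pull out \<open>E(u f)\<close>.
\<close>
lemma L2_inner_wEu:
  assumes wu: "bounded_pair w u K" and f: "f \<in> L2 M" and g: "g \<in> L2 M"
  shows "integrable M (\<lambda>x. E (\<lambda>y. u y * f y) x * E (\<lambda>y. w y * cnj (g y)) x)"
    "L2_inner M (wEu w u f) g = (LINT x|M. E (\<lambda>y. u y * f y) x * E (\<lambda>y. w y * cnj (g y)) x)"
proof -
  have w: "w \<in> cond_L2" and u: "u \<in> cond_L2"
    using wu by (auto simp: bounded_pair_def)
  note [measurable] = cond_L2_measurable[OF w] cond_L2_measurable[OF u] L2_measurable[OF f] L2_measurable[OF g]
  let ?e = "E (\<lambda>y. u y * f y)"
  have int: "integrable M (\<lambda>x. ?e x * (w x * cnj (g x)))"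
    using L2_integrable_inner[OF wEu_bound(1)[OF wu f] g] by (simp add: weighted_cond_op_def mult_ac)
  have eq: "AE x in M. E (\<lambda>x. ?e x * (w x * cnj (g x))) x = ?e x * E (\<lambda>y. w y * cnj (g y)) x"
    by (intro E_mult mult_in_dom_E w cond_L2_cnj L2_imp_cond_L2 g) measurable
  show "integrable M (\<lambda>x. ?e x * E (\<lambda>y. w y * cnj (g y)) x)"
    by (rule integrable_cong_AE_imp[OF E_integral(1)[OF int] _ eq]) measurable
  have "L2_inner M (wEu w u f) g = (LINT x|M. ?e x * (w x * cnj (g x)))"
    by (simp add: L2_inner_def weighted_cond_op_def mult_ac)
  also have "\<dots> = (LINT x|M. E (\<lambda>x. ?e x * (w x * cnj (g x))) x)"
    by (rule E_integral(2)[OF int, symmetric])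
  also have "\<dots> = (LINT x|M. ?e x * E (\<lambda>y. w y * cnj (g y)) x)"
    by (rule integral_cong_AE) (use eq in auto)
  finally show "L2_inner M (wEu w u f) g = (LINT x|M. ?e x * E (\<lambda>y. w y * cnj (g y)) x)" .
qed

lemma L2_inner_wEu_adjoint:
  assumes wu: "bounded_pair w u K" and f: "f \<in> L2 M" and g: "g \<in> L2 M"
  shows "L2_inner M (wEu w u f) g = L2_inner M f (wEu (\<lambda>x. cnj (u x)) (\<lambda>x. cnj (w x)) g)"
proof -
  have "L2_inner M f (wEu (\<lambda>x. cnj (u x)) (\<lambda>x. cnj (w x)) g)
      = cnj (LINT x|M. E (\<lambda>y. cnj (w y) * g y) x * E (\<lambda>y. cnj (u y) * cnj (f y)) x)"
    unfolding L2_inner_wEu(2)[OF bounded_pair_cnj[OF wu] g f, symmetric] by (rule L2_inner_commute)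
  also have "\<dots> = (LINT x|M. cnj (E (\<lambda>y. cnj (w y) * g y) x * E (\<lambda>y. cnj (u y) * cnj (f y)) x))"
    by (rule Bochner_Integration.integral_cnj[symmetric])
  also have "\<dots> = (LINT x|M. E (\<lambda>y. u y * f y) x * E (\<lambda>y. w y * cnj (g y)) x)"
    by (simp add: E_cnj[symmetric] mult.commute[of _ "E (\<lambda>y. w y * cnj (g y)) _"] del: Bochner_Integration.integral_cnj)
  finally show ?thesis using L2_inner_wEu(2)[OF wu f g] by simp
qed

text \<open>
  Adjoints and powers are obtained by a choice and are determined only on \<open>L\<^sup>2\<close> and up to null sets,
  so that they can be compared with weighted conditional operators only in this sense.
\<close>
definition acts_as :: "'a fun_op \<Rightarrow> ('a \<Rightarrow> complex) \<Rightarrow> ('a \<Rightarrow> complex) \<Rightarrow> bool" where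
  "acts_as A w u \<longleftrightarrow> (\<forall>f\<in>L2 M. AE x in M. A f x = wEu w u f x)"

lemma acts_asD: "acts_as A w u \<Longrightarrow> f \<in> L2 M \<Longrightarrow> AE x in M. A f x = w x * E (\<lambda>y. u y * f y) x"
  by (simp add: acts_as_def weighted_cond_op_def)

lemma acts_as_cong:
  assumes "acts_as A w u" "AE x in M. w x = w' x"
  shows "acts_as A w' u"
  unfolding acts_as_def weighted_cond_op_def
proof
  fix f assume "f \<in> L2 M"
  from acts_asD[OF assms(1) this] assms(2)
  show "AE x in M. A f x = w' x * E (\<lambda>y. u y * f y) x" by eventually_elim simp
qed

text \<open>
  The weighted conditional operator with conjugated and exchanged weights has the adjoint property,
  and the adjoint is unique up to null sets.
\<close>
lemma adjoint_acts_as: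
  assumes T: "L2_bounded M T" "acts_as T w u" and wu: "bounded_pair w u K"
  shows "L2_bounded M (L2_adjoint M T)" "acts_as (L2_adjoint M T) (\<lambda>x. cnj (u x)) (\<lambda>x. cnj (w x))"
proof -
  let ?S = "wEu (\<lambda>x. cnj (u x)) (\<lambda>x. cnj (w x))"
  have [measurable]: "w \<in> borel_measurable M"
    using wu by (simp add: bounded_pair_def cond_L2_measurable)
  have T_L2: "T f \<in> L2 M" if "f \<in> L2 M" for f
    using T(1) that by (simp add: L2_bounded_def)
  have adj: "L2_inner M (T f) g = L2_inner M f (?S g)" if f: "f \<in> L2 M" and g: "g \<in> L2 M" for f g
  proof -
    have "L2_inner M (T f) g = L2_inner M (wEu w u f) g"
      by (rule L2_inner_cong_AE)
        (use T(2) T_L2[OF f] f g in \<open>auto simp: acts_as_def intro: L2_measurable wEu_measurable\<close>)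
    then show ?thesis using L2_inner_wEu_adjoint[OF wu f g] by simp
  qed
  have S_bdd: "L2_bounded M ?S"
    by (rule wEu_L2_bounded[OF bounded_pair_cnj[OF wu]])
  define P where "P B \<longleftrightarrow> L2_bounded M B \<and> (\<forall>f\<in>L2 M. \<forall>g\<in>L2 M. L2_inner M (T f) g = L2_inner M f (B g))" for B
  have "P ?S" using adj S_bdd by (simp add: P_def)
  then have PT: "P (L2_adjoint M T)"
    unfolding L2_adjoint_def P_def[symmetric] by (rule someI[where P = P])
  then have adj': "L2_inner M (T f) g = L2_inner M f (L2_adjoint M T g)" if "f \<in> L2 M" "g \<in> L2 M" for f g
    using that by (auto simp: P_def)
  show bdd': "L2_bounded M (L2_adjoint M T)"
    using PT by (simp add: P_def)
  have "AE x in M. L2_adjoint M T g x = ?S g x" if "g \<in> L2 M" for g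
  proof (rule L2_adjoint_unique[OF _ _ _ that])
    show "L2_inner M f (L2_adjoint M T h) = L2_inner M f (?S h)" if "f \<in> L2 M" "h \<in> L2 M" for f h
      using adj[OF that] adj'[OF that] by simp
  qed (use bdd' S_bdd in \<open>auto simp: L2_bounded_def\<close>)
  then show "acts_as (L2_adjoint M T) (\<lambda>x. cnj (u x)) (\<lambda>x. cnj (w x))"
    by (simp add: acts_as_def)
qed

lemma E_mult_cong_right:
  assumes "u \<in> borel_measurable M" "f \<in> borel_measurable M" "g \<in> borel_measurable M" "AE x in M. f x = g x"
  shows "AE x in M. E (\<lambda>y. u y * f y) x = E (\<lambda>y. u y * g y) x"
  by (rule E_cong) (use assms in auto)

text \<open>
  Since \<open>E(u' f)\<close> is \<open>F\<close>-measurable, \<open>w E(u w' E(u' f)) = w E(u w') E(u' f)\<close>.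
\<close>
lemma acts_as_comp:
  assumes A: "acts_as A w u" and B: "acts_as B w' u'" and B_L2: "\<And>f. f \<in> L2 M \<Longrightarrow> B f \<in> L2 M"
    and u: "u \<in> cond_L2" and w': "w' \<in> cond_L2"
  shows "acts_as (A \<circ> B) (\<lambda>x. w x * E (\<lambda>y. u y * w' y) x) u'"
  unfolding acts_as_def weighted_cond_op_def
proof
  fix f assume f: "f \<in> L2 M"
  note [measurable] = cond_L2_measurable[OF u] cond_L2_measurable[OF w'] L2_measurable[OF f] L2_measurable[OF B_L2[OF f]]
  let ?e = "E (\<lambda>y. u' y * f y)"
  have "AE x in M. E (\<lambda>y. u y * B f y) x = E (\<lambda>y. u y * (?e y * w' y)) x"
    using acts_asD[OF B f] by (intro E_mult_cong_right) (measurable, simp add: mult.commute)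
  moreover have "AE x in M. E (\<lambda>y. u y * (?e y * w' y)) x = ?e x * E (\<lambda>y. u y * w' y) x"
    by (intro E_mult_scale_right u w') measurable
  moreover note acts_asD[OF A B_L2[OF f]]
  ultimately show "AE x in M. (A \<circ> B) f x = w x * E (\<lambda>y. u y * w' y) x * E (\<lambda>y. u' y * f y) x"
    by eventually_elim simp
qed

section \<open>Boundedness forces a bound on the weights\<close>

text \<open>
  Test with the part of \<open>{Y < X}\<close> where \<open>Y\<close> is bounded: there \<open>\<integral> Y\<close> is finite and can be
  cancelled.
\<close>
lemma AE_le_if_nn_integral_le:
  fixes X Y :: "'a \<Rightarrow> ennreal"
  assumes [measurable]: "X \<in> borel_measurable F" "Y \<in> borel_measurable F"
    and fin: "AE x in M. Y x < \<infinity>"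
    and le: "\<And>D. D \<in> sets F \<Longrightarrow> emeasure M D < \<infinity> \<Longrightarrow>
      (\<integral>\<^sup>+x. indicator D x * X x \<partial>M) \<le> (\<integral>\<^sup>+x. indicator D x * Y x \<partial>M)"
  shows "AE x in M. X x \<le> Y x"
proof (rule AE_localize[OF _ fin])
  note [measurable] = F_imp_M[OF assms(1)] F_imp_M[OF assms(2)]
  fix A n assume A[measurable]: "A \<in> sets F" and Afin: "emeasure M A < \<infinity>" and n: "\<And>x. x \<in> A \<Longrightarrow> Y x \<le> of_nat n"
  define D where "D = A \<inter> {x \<in> space F. Y x < X x}"
  have D[measurable]: "D \<in> sets F" unfolding D_def by measurable
  note [measurable] = sets_F_imp_M[OF D]
  have "emeasure M D \<le> emeasure M A"
    by (rule emeasure_mono) (auto simp: D_def intro: sets_F_imp_M)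
  then have Dfin: "emeasure M D < \<infinity>" using Afin by auto
  let ?I = "\<integral>\<^sup>+x. indicator D x * Y x \<partial>M"
  have "?I \<le> (\<integral>\<^sup>+x. of_nat n * indicator D x \<partial>M)"
    by (intro nn_integral_mono) (auto simp: indicator_def n D_def)
  also have "\<dots> = of_nat n * emeasure M D" by (simp add: nn_integral_cmult_indicator)
  also have "\<dots> < \<infinity>" using Dfin by (simp add: ennreal_mult_less_top of_nat_less_top)
  finally have I_fin: "?I < \<infinity>" .
  have "(\<integral>\<^sup>+x. indicator D x * X x \<partial>M) = (\<integral>\<^sup>+x. indicator D x * Y x + indicator D x * (X x - Y x) \<partial>M)"
    by (intro nn_integral_cong) (auto simp: indicator_def D_def add_diff_inverse_ennreal less_imp_le)
  also have "\<dots> = ?I + (\<integral>\<^sup>+x. indicator D x * (X x - Y x) \<partial>M)"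
    by (rule nn_integral_add) measurable
  finally have "?I + (\<integral>\<^sup>+x. indicator D x * (X x - Y x) \<partial>M) \<le> ?I + 0"
    using le[OF D Dfin] by simp
  then have "(\<integral>\<^sup>+x. indicator D x * (X x - Y x) \<partial>M) = 0"
    unfolding ennreal_add_left_cancel_le using I_fin by auto
  then have "AE x in M. indicator D x * (X x - Y x) = 0"
    by (subst (asm) nn_integral_0_iff_AE) measurable
  then show "AE x in M. x \<in> A \<longrightarrow> X x \<le> Y x"
    using AE_space
  proof eventually_elim
    case (elim x)
    show ?case
    proof (intro impI, rule ccontr)
      assume "x \<in> A" "\<not> X x \<le> Y x"
      then have "x \<in> D" using elim(2) subalg by (auto simp: D_def subalgebra_def)
      then have "X x - Y x = 0" using elim(1) by simp
      then show False using \<open>\<not> X x \<le> Y x\<close> by (simp add: diff_eq_0_iff_ennreal)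
    qed
  qed
qed measurable

text \<open>
  Let \<open>v\<^sub>n\<close> be \<open>u\<close> cut off to \<open>0\<close> where \<open>|u| > n\<close>. For \<open>f = cnj v\<^sub>n 1\<^sub>D\<close> with \<open>D\<close> in \<open>F\<close>, the image of \<open>f\<close>
  is \<open>w E(|v\<^sub>n|\<^sup>2) 1\<^sub>D\<close>, so the bound reads \<open>\<integral>\<^sub>D E(|w|\<^sup>2) E(|v\<^sub>n|\<^sup>2)\<^sup>2 \<le> C\<^sup>2 \<integral>\<^sub>D E(|v\<^sub>n|\<^sup>2)\<close>. As \<open>D\<close> is arbitrary,
  \<open>E(|w|\<^sup>2) E(|v\<^sub>n|\<^sup>2) \<le> C\<^sup>2\<close>, and \<open>n\<close> tends to infinity. The truncation is what allows infinite values
  of \<open>E(|u|\<^sup>2)\<close>.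
\<close>
lemma Esq_mult_Esq_le:
  assumes [measurable]: "w \<in> borel_measurable M" "u \<in> borel_measurable M" and C: "0 \<le> C"
    and bound: "\<And>f. f \<in> L2 M \<Longrightarrow> wEu w u f \<in> L2 M \<and> L2_norm M (wEu w u f) \<le> C * L2_norm M f"
  shows "AE x in M. Esq w x * Esq u x \<le> ennreal (C\<^sup>2)"
proof -
  define v where "v n x = (if cmod (u x) \<le> real n then u x else 0)" for n :: nat and x
  have [measurable]: "v n \<in> borel_measurable M" for n
    unfolding v_def[abs_def] by measurable
  have v_le: "cmod (v n x) \<le> real n" for n x by (simp add: v_def)
  have uv: "u x * cnj (v n x) = complex_of_real ((cmod (v n x))\<^sup>2)" for n x
    by (simp add: v_def complex_norm_square del: of_real_power)
  have v_mono: "(cmod (v m x))\<^sup>2 \<le> (cmod (v n x))\<^sup>2" if "m \<le> n" for m n x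
    using that by (auto simp: v_def)
  have Esq_v: "AE x in M. Esq (v n) x \<le> ennreal ((real n)\<^sup>2)" for n
  proof -
    have "AE x in M. nn_cond_exp M F (\<lambda>y. ennreal ((cmod (v n y))\<^sup>2)) x \<le> nn_cond_exp M F (\<lambda>y. ennreal ((real n)\<^sup>2)) x"
      by (rule nn_cond_exp_mono) (auto intro!: AE_I2 ennreal_leI power_mono v_le)
    moreover have "AE x in M. ennreal ((real n)\<^sup>2) = nn_cond_exp M F (\<lambda>y. ennreal ((real n)\<^sup>2)) x"
      by (rule nn_cond_exp_F_meas) measurable
    ultimately show ?thesis by eventually_elim (simp add: cond_exp_sq_def)
  qed
  have *: "AE x in M. Esq w x * Esq (v n) x \<le> ennreal (C\<^sup>2)" for n
  proof -
    have "AE x in M. Esq w x * (Esq (v n) x)\<^sup>2 \<le> ennreal (C\<^sup>2) * Esq (v n) x"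
    proof (rule AE_le_if_nn_integral_le)
      show "AE x in M. ennreal (C\<^sup>2) * Esq (v n) x < \<infinity>"
        using Esq_v[of n] by eventually_elim (auto simp: ennreal_mult_less_top intro: le_less_trans)
      fix D assume D[measurable]: "D \<in> sets F" and Dfin: "emeasure M D < \<infinity>"
      note [measurable] = sets_F_imp_M[OF D]
      define f where "f x = indicator D x * cnj (v n x)" for x
      have [measurable]: "f \<in> borel_measurable M" unfolding f_def[abs_def] by measurable
      have nf: "(\<integral>\<^sup>+x. ennreal ((cmod (f x))\<^sup>2) \<partial>M) = (\<integral>\<^sup>+x. indicator D x * Esq (v n) x \<partial>M)"
        by (subst nn_integral_Esq) (auto intro!: nn_integral_cong simp: f_def indicator_def)
      also have "\<dots> \<le> (\<integral>\<^sup>+x. ennreal ((real n)\<^sup>2) * indicator D x \<partial>M)"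
        by (rule nn_integral_mono_AE, use Esq_v[of n] in eventually_elim) (simp add: indicator_def)
      also have "\<dots> = ennreal ((real n)\<^sup>2) * emeasure M D" by (simp add: nn_integral_cmult_indicator)
      also have "\<dots> < \<infinity>" using Dfin by (simp add: ennreal_mult_less_top)
      finally have f: "f \<in> L2 M" by (simp add: L2_iff)
      have uf: "(\<lambda>y. u y * f y) = (\<lambda>y. complex_of_real (indicator D y * (cmod (v n y))\<^sup>2))"
        by (auto simp: fun_eq_iff f_def uv indicator_def simp del: of_real_power)
      have "(\<lambda>y. ennreal (indicator D y * (cmod (v n y))\<^sup>2)) = (\<lambda>y. indicator D y * ennreal ((cmod (v n y))\<^sup>2))"
        by (auto simp: indicator_def)
      then have "AE x in M. E (\<lambda>y. u y * f y) x = complex_of_real (enn2real (nn_cond_exp M F (\<lambda>y. indicator D y * ennreal ((cmod (v n y))\<^sup>2)) x))"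
        using E_of_nonneg[of "\<lambda>y. indicator D y * (cmod (v n y))\<^sup>2"] unfolding uf by simp
      moreover have "AE x in M. indicator D x * Esq (v n) x = nn_cond_exp M F (\<lambda>y. indicator D y * ennreal ((cmod (v n y))\<^sup>2)) x"
        unfolding cond_exp_sq_def by (rule nn_cond_exp_prod) measurable
      ultimately have e: "AE x in M. ennreal ((cmod (E (\<lambda>y. u y * f y) x))\<^sup>2) = indicator D x * (Esq (v n) x)\<^sup>2"
        using Esq_v[of n]
      proof eventually_elim
        case (elim x)
        have "Esq (v n) x < \<infinity>" using elim(3) by (auto intro: le_less_trans)
        then have fin: "indicator D x * Esq (v n) x < \<infinity>" by (simp add: indicator_def)
        have "cmod (E (\<lambda>y. u y * f y) x) = enn2real (indicator D x * Esq (v n) x)"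
          using elim(1,2) by simp
        then have "ennreal (cmod (E (\<lambda>y. u y * f y) x)) = indicator D x * Esq (v n) x"
          using fin by simp
        then have "ennreal ((cmod (E (\<lambda>y. u y * f y) x))\<^sup>2) = (indicator D x * Esq (v n) x)\<^sup>2"
          by (metis ennreal_power norm_ge_zero)
        then show ?case by (simp add: indicator_def power_mult_distrib)
      qed
      have "(\<integral>\<^sup>+x. indicator D x * (Esq w x * (Esq (v n) x)\<^sup>2) \<partial>M) = (\<integral>\<^sup>+x. (indicator D x * (Esq (v n) x)\<^sup>2) * Esq w x \<partial>M)"
        by (simp add: mult_ac)
      also have "\<dots> = (\<integral>\<^sup>+x. (indicator D x * (Esq (v n) x)\<^sup>2) * ennreal ((cmod (w x))\<^sup>2) \<partial>M)"
        by (rule nn_integral_Esq) measurable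
      also have "\<dots> = (\<integral>\<^sup>+x. ennreal ((cmod (wEu w u f x))\<^sup>2) \<partial>M)"
        by (rule nn_integral_cong_AE, use e in eventually_elim)
          (simp add: weighted_cond_op_def norm_mult power_mult_distrib ennreal_mult mult.commute)
      also have "\<dots> = ennreal ((L2_norm M (wEu w u f))\<^sup>2)"
        by (rule nn_integral_L2_norm) (use bound[OF f] in simp)
      also have "\<dots> \<le> ennreal ((C * L2_norm M f)\<^sup>2)"
        by (intro ennreal_leI power_mono L2_norm_nonneg) (use bound[OF f] in simp)
      also have "\<dots> = ennreal (C\<^sup>2) * (\<integral>\<^sup>+x. ennreal ((cmod (f x))\<^sup>2) \<partial>M)"
        unfolding nn_integral_L2_norm[OF f] by (simp add: power_mult_distrib ennreal_mult)
      also have "\<dots> = (\<integral>\<^sup>+x. indicator D x * (ennreal (C\<^sup>2) * Esq (v n) x) \<partial>M)"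
        unfolding nf by (subst nn_integral_cmult[symmetric]) (auto simp: mult_ac)
      finally show "(\<integral>\<^sup>+x. indicator D x * (Esq w x * (Esq (v n) x)\<^sup>2) \<partial>M) \<le> (\<integral>\<^sup>+x. indicator D x * (ennreal (C\<^sup>2) * Esq (v n) x) \<partial>M)" .
    qed measurable
    then show ?thesis using Esq_v[of n]
    proof eventually_elim
      case (elim x)
      show ?case
      proof (cases "Esq (v n) x = 0")
        case False
        have fin: "Esq (v n) x < \<infinity>" using elim(2) by (auto intro: le_less_trans)
        have "Esq (v n) x * (Esq w x * Esq (v n) x) \<le> Esq (v n) x * ennreal (C\<^sup>2)"
          using elim(1) by (simp add: power2_eq_square mult_ac)
        then show ?thesis using False fin by (subst (asm) ennreal_mult_le_mult_iff) auto
      qed simp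
    qed
  qed
  have lim: "(SUP n. ennreal ((cmod (v n x))\<^sup>2)) = ennreal ((cmod (u x))\<^sup>2)" for x
  proof (rule antisym)
    show "(SUP n. ennreal ((cmod (v n x))\<^sup>2)) \<le> ennreal ((cmod (u x))\<^sup>2)"
      by (rule SUP_least) (auto simp: v_def)
    obtain n where "cmod (u x) \<le> real n" using real_arch_simple by blast
    show "ennreal ((cmod (u x))\<^sup>2) \<le> (SUP n. ennreal ((cmod (v n x))\<^sup>2))"
      by (rule SUP_upper2[of n]) (use \<open>cmod (u x) \<le> real n\<close> in \<open>simp_all add: v_def\<close>)
  qed
  show ?thesis
  proof (rule AE_le_if_nn_integral_le)
    fix D assume D[measurable]: "D \<in> sets F"
    note [measurable] = sets_F_imp_M[OF D]
    have "(\<integral>\<^sup>+x. indicator D x * (Esq w x * Esq u x) \<partial>M) = (\<integral>\<^sup>+x. (indicator D x * Esq w x) * Esq u x \<partial>M)"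
      by (simp add: mult_ac)
    also have "\<dots> = (\<integral>\<^sup>+x. (indicator D x * Esq w x) * ennreal ((cmod (u x))\<^sup>2) \<partial>M)"
      by (rule nn_integral_Esq) measurable
    also have "\<dots> = (\<integral>\<^sup>+x. (SUP n. (indicator D x * Esq w x) * ennreal ((cmod (v n x))\<^sup>2)) \<partial>M)"
      unfolding lim[symmetric] SUP_mult_left_ennreal ..
    also have "\<dots> = (SUP n. (\<integral>\<^sup>+x. (indicator D x * Esq w x) * ennreal ((cmod (v n x))\<^sup>2) \<partial>M))"
      by (rule nn_integral_monotone_convergence_SUP)
        (auto simp: incseq_def le_fun_def intro!: mult_left_mono ennreal_leI v_mono)
    also have "\<dots> \<le> (\<integral>\<^sup>+x. indicator D x * ennreal (C\<^sup>2) \<partial>M)"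
    proof (rule SUP_least)
      fix n
      have "(\<integral>\<^sup>+x. (indicator D x * Esq w x) * ennreal ((cmod (v n x))\<^sup>2) \<partial>M) = (\<integral>\<^sup>+x. (indicator D x * Esq w x) * Esq (v n) x \<partial>M)"
        by (rule nn_integral_Esq[symmetric]) measurable
      also have "\<dots> \<le> (\<integral>\<^sup>+x. indicator D x * ennreal (C\<^sup>2) \<partial>M)"
        by (rule nn_integral_mono_AE, use *[of n] in eventually_elim) (simp add: mult.assoc mult_left_mono)
      finally show "(\<integral>\<^sup>+x. (indicator D x * Esq w x) * ennreal ((cmod (v n x))\<^sup>2) \<partial>M) \<le> (\<integral>\<^sup>+x. indicator D x * ennreal (C\<^sup>2) \<partial>M)" .
    qed
    finally show "(\<integral>\<^sup>+x. indicator D x * (Esq w x * Esq u x) \<partial>M) \<le> (\<integral>\<^sup>+x. indicator D x * ennreal (C\<^sup>2) \<partial>M)" .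
  qed auto
qed

section \<open>Real powers\<close>

lemma has_bound_acts_as:
  assumes A: "acts_as A w u" and wu: "bounded_pair w u K"
    and L: "\<And>f. f \<in> L2 M \<Longrightarrow> A f \<in> borel_measurable M"
  shows "L2_has_bound M A K"
  unfolding L2_has_bound_def
proof (intro conjI ballI)
  show "0 \<le> K" using wu by (simp add: bounded_pair_def)
  fix f assume f: "f \<in> L2 M"
  have ae: "AE x in M. A f x = wEu w u f x" using A f by (simp add: acts_as_def)
  show "A f \<in> L2 M" by (rule L2_cong_AE[OF L[OF f] wEu_bound(1)[OF wu f] ae])
  show "L2_norm M (A f) \<le> K * L2_norm M f"
    using wEu_bound[OF wu f] L2_norm_cong_AE[OF L[OF f] L2_measurable[OF wEu_bound(1)[OF wu f]] ae] by simp
qed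

lemma E_eq_0_if_Esq_eq_0:
  assumes "u \<in> cond_L2" "f \<in> cond_L2"
  shows "AE x in M. enn2real (Esq u x) = 0 \<longrightarrow> E (\<lambda>y. u y * f y) x = 0"
  using cond_Cauchy_Schwarz[OF assms] cond_L2_finite[OF assms(1)]
  by eventually_elim (auto simp: enn2real_eq_0_iff)

lemma E_mult_cnj_scaled:
  assumes v: "v \<in> cond_L2" and m: "m \<in> borel_measurable F"
  shows "AE x in M. E (\<lambda>y. v y * (m y * cnj (v y))) x = m x * complex_of_real (enn2real (Esq v x))"
  using E_mult_scale_right[OF v cond_L2_cnj[OF v] m] E_mult_cnj_self[OF cond_L2_measurable[OF v]]
  by eventually_elim simp

text \<open>
  On functions \<open>c cnj v\<close> with \<open>F\<close>-measurable \<open>c\<close>, the operator \<open>A\<close> is multiplication by \<open>k b\<close>. The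
  term \<open>0\<^sup>i\<close> covers \<open>i = 0\<close> and makes the formula linear in the powers \<open>(k b)\<^sup>i\<close>, ready for polynomials.
  Where \<open>b = 0\<close>, the quotient is \<open>0\<close> and so is \<open>E(v f)\<close>.
\<close>
lemma op_iterate_acts_as:
  fixes k :: "'a \<Rightarrow> real"
  assumes v: "v \<in> cond_L2" and k[measurable]: "k \<in> borel_measurable F"
    and A_L2: "\<forall>f\<in>L2 M. A f \<in> L2 M"
    and A: "acts_as A (\<lambda>x. cnj (v x) * complex_of_real (k x)) v" and f: "f \<in> L2 M"
  defines "b \<equiv> \<lambda>x. enn2real (Esq v x)"
  shows "(A ^^ i) f \<in> L2 M"
    "AE x in M. (A ^^ i) f x = 0 ^ i * f x +
       cnj (v x) * complex_of_real (((k x * b x) ^ i - 0 ^ i) / b x) * E (\<lambda>y. v y * f y) x"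
proof -
  show L: "(A ^^ i) f \<in> L2 M" for i
    by (induction i) (use f A_L2 in auto)
  note [measurable] = cond_L2_measurable[OF v] L2_measurable[OF f]
  have [measurable]: "b \<in> borel_measurable F" unfolding b_def by measurable
  note [measurable] = F_imp_M[OF k]
  have [measurable]: "b \<in> borel_measurable M" by (rule F_imp_M) measurable
  let ?e = "E (\<lambda>y. v y * f y)"
  show "AE x in M. (A ^^ i) f x = 0 ^ i * f x +
       cnj (v x) * complex_of_real (((k x * b x) ^ i - 0 ^ i) / b x) * ?e x"
  proof (induction i)
    case (Suc i)
    define c where "c x = complex_of_real (((k x * b x) ^ i - 0 ^ i) / b x) * ?e x" for x
    have [measurable]: "c \<in> borel_measurable F" unfolding c_def[abs_def] by measurable
    have [measurable]: "c \<in> borel_measurable M" by (rule F_imp_M) measurable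
    have f': "(\<lambda>x. 0 ^ i * f x) \<in> cond_L2" and cv: "(\<lambda>x. c x * cnj (v x)) \<in> cond_L2"
      by (intro cond_L2_mult L2_imp_cond_L2 f cond_L2_cnj v; measurable)+
    have "AE x in M. E (\<lambda>y. v y * (A ^^ i) f y) x = E (\<lambda>y. v y * (0 ^ i * f y + c y * cnj (v y))) x"
    proof (rule E_mult_cong_right)
      show "AE x in M. (A ^^ i) f x = 0 ^ i * f x + c x * cnj (v x)"
        using Suc.IH by eventually_elim (simp add: c_def)
    qed (measurable, rule L2_measurable[OF L], measurable)
    moreover have "AE x in M. E (\<lambda>y. v y * (0 ^ i * f y + c y * cnj (v y))) x =
        E (\<lambda>y. v y * (0 ^ i * f y)) x + E (\<lambda>y. v y * (c y * cnj (v y))) x"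
      by (rule E_mult_add_right[OF v f' cv])
    moreover have "AE x in M. E (\<lambda>y. v y * (0 ^ i * f y)) x = 0 ^ i * ?e x"
      by (intro E_mult_scale_right v L2_imp_cond_L2 f) measurable
    moreover have "AE x in M. E (\<lambda>y. v y * (c y * cnj (v y))) x = c x * complex_of_real (b x)"
      unfolding b_def by (rule E_mult_cnj_scaled[OF v]) measurable
    moreover have "AE x in M. b x = 0 \<longrightarrow> ?e x = 0"
      unfolding b_def by (intro E_eq_0_if_Esq_eq_0 v L2_imp_cond_L2 f)
    moreover have "AE x in M. A ((A ^^ i) f) x = cnj (v x) * complex_of_real (k x) * E (\<lambda>y. v y * (A ^^ i) f y) x"
      by (rule acts_asD[OF A L])
    ultimately show ?case
    proof eventually_elim
      case (elim x)
      have "(A ^^ Suc i) f x = cnj (v x) * complex_of_real (k x) * (0 ^ i * ?e x + c x * complex_of_real (b x))"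
        using elim by simp
      also have "\<dots> = 0 ^ Suc i * f x + cnj (v x) * complex_of_real (((k x * b x) ^ Suc i - 0 ^ Suc i) / b x) * ?e x"
        using elim(5) by (cases "b x = 0"; cases i) (auto simp: c_def)
      finally show ?case .
    qed
  qed simp
qed

lemma op_poly_acts_as:
  fixes k :: "'a \<Rightarrow> real"
  assumes v: "v \<in> cond_L2" and k: "k \<in> borel_measurable F"
    and A_L2: "\<forall>f\<in>L2 M. A f \<in> L2 M"
    and A: "acts_as A (\<lambda>x. cnj (v x) * complex_of_real (k x)) v" and f: "f \<in> L2 M"
  defines "b \<equiv> \<lambda>x. enn2real (Esq v x)"
  shows "op_poly q A f \<in> borel_measurable M"
    "AE x in M. op_poly q A f x = complex_of_real (poly q 0) * f x +
       cnj (v x) * complex_of_real ((poly q (k x * b x) - poly q 0) / b x) * E (\<lambda>y. v y * f y) x"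
proof -
  have [measurable]: "(A ^^ i) f \<in> borel_measurable M" for i
    by (rule L2_measurable[OF op_iterate_acts_as(1)[OF v k A_L2 A f]])
  show "op_poly q A f \<in> borel_measurable M"
    unfolding op_poly_def[abs_def] by measurable
  have "AE x in M. \<forall>i. (A ^^ i) f x = 0 ^ i * f x +
       cnj (v x) * complex_of_real (((k x * b x) ^ i - 0 ^ i) / b x) * E (\<lambda>y. v y * f y) x"
    unfolding AE_all_countable b_def using op_iterate_acts_as(2)[OF v k A_L2 A f] by blast
  then show "AE x in M. op_poly q A f x = complex_of_real (poly q 0) * f x +
       cnj (v x) * complex_of_real ((poly q (k x * b x) - poly q 0) / b x) * E (\<lambda>y. v y * f y) x"
  proof eventually_elim
    case (elim x)
    let ?s = "k x * b x" and ?e = "E (\<lambda>y. v y * f y) x"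
    have "op_poly q A f x = (\<Sum>i\<le>degree q. complex_of_real (coeff q i * 0 ^ i) * f x +
        cnj (v x) * complex_of_real ((coeff q i * ?s ^ i - coeff q i * 0 ^ i) / b x) * ?e)"
      unfolding op_poly_def
      by (intro sum.cong refl, subst elim[rule_format]) (simp add: algebra_simps diff_divide_distrib add_divide_distrib)
    also have "\<dots> = complex_of_real (\<Sum>i\<le>degree q. coeff q i * 0 ^ i) * f x +
        cnj (v x) * complex_of_real (((\<Sum>i\<le>degree q. coeff q i * ?s ^ i) - (\<Sum>i\<le>degree q. coeff q i * 0 ^ i)) / b x) * ?e"
      unfolding sum.distrib sum_subtractf[symmetric] sum_divide_distrib of_real_sum sum_distrib_left sum_distrib_right ..
    finally show ?case by (simp only: poly_altdef)
  qed
qed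

text \<open>
  \<open>E(|g cnj v|\<^sup>2) E(|v|\<^sup>2) = (g E(|v|\<^sup>2))\<^sup>2\<close>.
\<close>
lemma bounded_pair_functional:
  fixes g :: "'a \<Rightarrow> real"
  assumes v: "v \<in> cond_L2" and g[measurable]: "g \<in> borel_measurable F"
    and K: "0 \<le> K" "AE x in M. \<bar>g x * enn2real (Esq v x)\<bar> \<le> K"
  shows "bounded_pair (\<lambda>x. cnj (v x) * complex_of_real (g x)) v K"
proof -
  let ?g = "\<lambda>x. complex_of_real (g x)"
  have eq: "(\<lambda>x. cnj (v x) * ?g x) = (\<lambda>x. ?g x * cnj (v x))" by (simp add: mult.commute)
  have "AE x in M. Esq (\<lambda>x. ?g x * cnj (v x)) x = ennreal ((cmod (?g x))\<^sup>2) * Esq (\<lambda>x. cnj (v x)) x"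
    by (intro Esq_mult cond_L2_measurable cond_L2_cnj v) measurable
  then have "AE x in M. Esq (\<lambda>x. ?g x * cnj (v x)) x * Esq v x \<le> ennreal (K\<^sup>2)"
    using cond_L2_finite[OF v] K(2)
  proof eventually_elim
    case (elim x)
    define b where "b = enn2real (Esq v x)"
    have b: "Esq v x = ennreal b" "0 \<le> b" using elim(2) by (auto simp: b_def)
    have "(g x * b)\<^sup>2 \<le> K\<^sup>2"
      using elim(3) K(1) by (metis abs_ge_zero b_def power2_abs power_mono)
    then have "ennreal ((g x)\<^sup>2 * b * b) \<le> ennreal (K\<^sup>2)"
      by (intro ennreal_leI) (simp add: power2_eq_square mult_ac)
    then show ?case using b elim(1) by (simp add: ennreal_mult)
  qed
  then show ?thesis
    unfolding eq bounded_pair_def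
    using K(1) v by (intro conjI cond_L2_mult cond_L2_cnj) measurable
qed

text \<open>
  For \<open>k \<ge> 0\<close>, this places the product \<open>k E(|v|\<^sup>2)\<close> in the interval \<open>[0, \<parallel>A\<parallel>]\<close> on which the polynomials
  approximating \<open>t\<^sup>p\<close> are controlled.
\<close>
lemma spectral_density_le_opnorm:
  fixes k :: "'a \<Rightarrow> real"
  assumes v: "v \<in> cond_L2" and k[measurable]: "k \<in> borel_measurable F"
    and bound: "L2_has_bound M A K"
    and A: "acts_as A (\<lambda>x. cnj (v x) * complex_of_real (k x)) v"
  shows "AE x in M. k x * enn2real (Esq v x) \<le> L2_opnorm M A"
proof -
  note [measurable] = F_imp_M[OF k] cond_L2_measurable[OF v]
  let ?w = "\<lambda>x. cnj (v x) * complex_of_real (k x)"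
  have "AE x in M. Esq ?w x * Esq v x \<le> ennreal ((L2_opnorm M A)\<^sup>2)"
  proof (rule Esq_mult_Esq_le)
    show "0 \<le> L2_opnorm M A" by (rule L2_opnorm_nonneg[OF bound])
    fix f assume f: "f \<in> L2 M"
    have ae: "AE x in M. wEu ?w v f x = A f x" using A f by (auto simp: acts_as_def)
    have Rm: "wEu ?w v f \<in> borel_measurable M" by (rule wEu_measurable) measurable
    note Af = L2_has_boundD(2)[OF bound f]
    show "wEu ?w v f \<in> L2 M \<and> L2_norm M (wEu ?w v f) \<le> L2_opnorm M A * L2_norm M f"
      using L2_cong_AE[OF Rm Af ae] L2_norm_cong_AE[OF Rm L2_measurable[OF Af] ae]
        L2_norm_le_opnorm[OF bound f] by simp
  qed measurable
  moreover have "AE x in M. Esq (\<lambda>x. complex_of_real (k x) * cnj (v x)) x = ennreal ((cmod (complex_of_real (k x)))\<^sup>2) * Esq (\<lambda>x. cnj (v x)) x"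
    by (intro Esq_mult) measurable
  moreover note cond_L2_finite[OF v]
  ultimately show ?thesis
  proof eventually_elim
    case (elim x)
    define b where "b = enn2real (Esq v x)"
    have b: "Esq v x = ennreal b" "0 \<le> b" using elim(3) by (auto simp: b_def)
    have "ennreal ((k x * b)\<^sup>2) \<le> ennreal ((L2_opnorm M A)\<^sup>2)"
      using elim(1,2) b by (simp add: mult.commute[of "cnj _"] ennreal_mult power2_eq_square[of b] power_mult_distrib mult.assoc)
    then have "(k x * b)\<^sup>2 \<le> (L2_opnorm M A)\<^sup>2" by simp
    then show ?case
      unfolding b_def[symmetric] using L2_opnorm_nonneg[OF bound] by (rule power2_le_imp_le)
  qed
qed

text \<open>
  Let \<open>b = E(|v|\<^sup>2)\<close>, \<open>s = k b\<close> and let \<open>B\<^sub>0\<close> be the operator with weights \<open>cnj v s\<^sup>p / b, v\<close>. Then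
  \<open>q(A) - B\<^sub>0\<close> is \<open>q(0)\<close> times the identity plus the operator with weights
  \<open>cnj v (q(s) - q(0) - s\<^sup>p) / b, v\<close>. If \<open>|q(t) - t\<^sup>p| \<le> \<epsilon>\<close> on \<open>[0, \<parallel>A\<parallel>]\<close>, then \<open>|q(0)| \<le> \<epsilon>\<close> and the second
  operator has norm at most \<open>2 \<epsilon>\<close>. So \<open>B\<^sub>0\<close> is the limit of \<open>q\<^sub>n(A)\<close> for every admissible sequence, and the
  limit along one such sequence is unique up to null sets.
\<close>
lemma op_powr_acts_as:
  fixes k :: "'a \<Rightarrow> real"
  assumes v: "v \<in> cond_L2" and k[measurable]: "k \<in> borel_measurable F" and k0: "\<And>x. 0 \<le> k x"
    and bound: "L2_has_bound M A K"
    and A: "acts_as A (\<lambda>x. cnj (v x) * complex_of_real (k x)) v" and p: "0 < p"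
  shows "L2_bounded M (L2_op_powr M A p)"
    "acts_as (L2_op_powr M A p)
       (\<lambda>x. cnj (v x) * complex_of_real ((k x * enn2real (Esq v x)) powr p / enn2real (Esq v x))) v"
proof -
  define b where "b x = enn2real (Esq v x)" for x
  define s where "s x = k x * b x" for x
  define N where "N = L2_opnorm M A"
  have N: "0 \<le> N" unfolding N_def by (rule L2_opnorm_nonneg[OF bound])
  note [measurable] = cond_L2_measurable[OF v]
  have [measurable]: "b \<in> borel_measurable F" unfolding b_def[abs_def] by measurable
  have [measurable]: "s \<in> borel_measurable F" unfolding s_def[abs_def] by measurable
  have s: "0 \<le> s x" for x using k0 by (simp add: s_def b_def)
  have sN: "AE x in M. s x \<le> N"
    unfolding s_def b_def N_def by (rule spectral_density_le_opnorm[OF v k bound A])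
  have s0: "b x = 0 \<Longrightarrow> s x = 0" for x by (simp add: s_def)
  define B0 where "B0 = wEu (\<lambda>x. cnj (v x) * complex_of_real (s x powr p / b x)) v"
  have pair: "bounded_pair (\<lambda>x. cnj (v x) * complex_of_real (g x / b x)) v c"
    if [measurable]: "g \<in> borel_measurable F" and c: "0 \<le> c" "AE x in M. \<bar>g x\<bar> \<le> c" for g :: "'a \<Rightarrow> real" and c
  proof (rule bounded_pair_functional[OF v _ c(1)])
    show "AE x in M. \<bar>g x / b x * enn2real (Esq v x)\<bar> \<le> c"
      using c(2) by eventually_elim (use c(1) in \<open>auto simp flip: b_def\<close>)
  qed measurable
  have B0_pair: "bounded_pair (\<lambda>x. cnj (v x) * complex_of_real (s x powr p / b x)) v (N powr p)"
  proof (rule pair)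
    show "AE x in M. \<bar>s x powr p\<bar> \<le> N powr p"
      using sN by eventually_elim (use s p in \<open>auto intro: powr_mono2\<close>)
  qed auto
  have B0_bdd: "L2_bounded M B0" unfolding B0_def by (rule wEu_L2_bounded[OF B0_pair])
  \<comment> \<open>from \<open>\<parallel>x + y\<parallel>\<^sup>2 \<le> 2 \<parallel>x\<parallel>\<^sup>2 + 2 \<parallel>y\<parallel>\<^sup>2\<close> with norms \<open>e\<close> and \<open>2 e\<close>: \<open>2 e\<^sup>2 + 8 e\<^sup>2 \<le> (4 e)\<^sup>2\<close>\<close>
  have approx: "L2_has_bound M (\<lambda>f x. op_poly q A f x - B0 f x) (4 * e)"
    if e: "0 \<le> e" and q: "\<And>t. t \<in> {0..N} \<Longrightarrow> \<bar>poly q t - t powr p\<bar> \<le> e" for q e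
    unfolding L2_has_bound_def
  proof (intro conjI ballI)
    show "0 \<le> 4 * e" using e by simp
    \<comment> \<open>uses \<open>0 powr p = 0\<close>\<close>
    have q0: "\<bar>poly q 0\<bar> \<le> e" using q[of 0] N by simp
    define g where "g x = poly q (s x) - poly q 0 - s x powr p" for x
    let ?G = "wEu (\<lambda>x. cnj (v x) * complex_of_real (g x / b x)) v"
    have G_pair: "bounded_pair (\<lambda>x. cnj (v x) * complex_of_real (g x / b x)) v (2 * e)"
    proof (rule pair)
      have "continuous_on UNIV (poly q)" by (intro continuous_intros)
      then have [measurable]: "poly q \<in> borel_measurable borel" by (rule borel_measurable_continuous_onI)
      show "g \<in> borel_measurable F" unfolding g_def[abs_def] by measurable
      show "AE x in M. \<bar>g x\<bar> \<le> 2 * e"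
        using sN
      proof eventually_elim
        case (elim x)
        then have "\<bar>poly q (s x) - s x powr p\<bar> \<le> e" using s by (intro q) auto
        then show ?case using q0 by (simp add: g_def)
      qed
    qed (use e in simp)
    fix f assume f: "f \<in> L2 M"
    define D where "D x = op_poly q A f x - B0 f x" for x
    have "\<forall>f\<in>L2 M. A f \<in> L2 M" using bound by (simp add: L2_has_bound_def)
    note op = op_poly_acts_as[OF v k this A f, of q]
    have B0f: "B0 f \<in> L2 M" using B0_bdd f by (simp add: L2_bounded_def)
    have D_meas: "D \<in> borel_measurable M"
      unfolding D_def[abs_def] using op(1) L2_measurable[OF B0f] by measurable
    have D_eq: "AE x in M. D x = complex_of_real (poly q 0) * f x + ?G f x"
      using op(2)
    proof eventually_elim
      case (elim x)
      then show ?case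
        by (simp add: D_def B0_def g_def weighted_cond_op_def s_def b_def algebra_simps diff_divide_distrib add_divide_distrib)
    qed
    note Gf = wEu_bound[OF G_pair f] and qf = L2_scale[OF f, of "complex_of_real (poly q 0)"]
    note sum = L2_add[OF qf(1) Gf(1)]
    show "(\<lambda>x. op_poly q A f x - B0 f x) \<in> L2 M"
      unfolding D_def[symmetric] by (rule L2_cong_AE[OF D_meas sum(1) D_eq])
    let ?n = "L2_norm M f"
    have n: "0 \<le> ?n" by (rule L2_norm_nonneg)
    have "(L2_norm M D)\<^sup>2 = (L2_norm M (\<lambda>x. complex_of_real (poly q 0) * f x + ?G f x))\<^sup>2"
      using L2_norm_cong_AE[OF D_meas L2_measurable[OF sum(1)] D_eq] by simp
    also have "\<dots> \<le> 2 * (L2_norm M (\<lambda>x. complex_of_real (poly q 0) * f x))\<^sup>2 + 2 * (L2_norm M (?G f))\<^sup>2"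
      by (rule sum(2))
    also have "\<dots> \<le> 2 * (e * ?n)\<^sup>2 + 2 * (2 * e * ?n)\<^sup>2"
      using q0 n Gf(2) unfolding qf(2)
      by (intro add_mono mult_left_mono power_mono mult_right_mono) (auto intro: L2_norm_nonneg)
    also have "\<dots> \<le> (4 * e * ?n)\<^sup>2" by (simp add: power_mult_distrib)
    finally show "L2_norm M (\<lambda>x. op_poly q A f x - B0 f x) \<le> 4 * e * ?n"
      unfolding D_def[symmetric] by (rule power2_le_imp_le) (use e n in simp)
  qed
  define P where "P B \<longleftrightarrow> L2_bounded M B \<and>
     (\<forall>q :: nat \<Rightarrow> real poly.
        uniform_limit {0..N} (\<lambda>n t. poly (q n) t) (\<lambda>t. t powr p) sequentially \<longrightarrow>
        (\<lambda>n. L2_opnorm M (\<lambda>f x. op_poly (q n) A f x - B f x)) \<longlonglongrightarrow> 0)" for B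
  have "(\<lambda>n. L2_opnorm M (\<lambda>f x. op_poly (q n) A f x - B0 f x)) \<longlonglongrightarrow> 0"
    if q: "uniform_limit {0..N} (\<lambda>n t. poly (q n) t) (\<lambda>t. t powr p) sequentially" for q
  proof (rule tendstoI)
    fix e :: real assume e: "0 < e"
    then have "0 < e / 5" by simp
    from uniform_limitD[OF q this]
    show "\<forall>\<^sub>F n in sequentially. dist (L2_opnorm M (\<lambda>f x. op_poly (q n) A f x - B0 f x)) 0 < e"
    proof eventually_elim
      case (elim n)
      have "L2_has_bound M (\<lambda>f x. op_poly (q n) A f x - B0 f x) (4 * (e / 5))"
        by (rule approx) (use e elim in \<open>auto simp: dist_real_def less_imp_le\<close>)
      then show ?case using L2_opnorm_le L2_opnorm_nonneg e by (fastforce simp: dist_real_def)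
    qed
  qed
  then have "P B0" using B0_bdd by (simp add: P_def)
  then have PB: "P (L2_op_powr M A p)"
    unfolding L2_op_powr_def N_def[symmetric] P_def[symmetric] by (rule someI[where P = P])
  define B where "B = L2_op_powr M A p"
  have B: "L2_bounded M B" using PB by (simp add: P_def B_def)
  then show "L2_bounded M (L2_op_powr M A p)" by (simp add: B_def)
  obtain c0 c1 where c: "L2_has_bound M B0 c0" "L2_has_bound M B c1"
    using L2_bounded_has_bound[OF B] L2_bounded_has_bound[OF B0_bdd] by metis
  obtain q where q: "uniform_limit {0..N} (\<lambda>n t. poly (q n) t) (\<lambda>t. t powr p) sequentially"
    using ex_poly_uniform_limit_powr[OF p] by blast
  have lim: "(\<lambda>n. L2_opnorm M (\<lambda>f x. op_poly (q n) A f x - B f x)) \<longlonglongrightarrow> 0"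
    using PB q by (simp add: P_def B_def)
  have "AE x in M. B f x = B0 f x" if f: "f \<in> L2 M" for f
  proof -
    define d where "d x = B f x - B0 f x" for x
    let ?n = "L2_norm M f"
    have n: "0 \<le> ?n" by (rule L2_norm_nonneg)
    have d_L2: "d \<in> L2 M"
      unfolding d_def[abs_def] by (rule L2_diff(1)[OF L2_has_boundD(2)[OF c(2) f] L2_has_boundD(2)[OF c(1) f]])
    have le: "L2_norm M d \<le> e * (8 * ?n)" if e: "0 < e" for e
    proof -
      have "\<forall>\<^sub>F n in sequentially. (\<forall>t\<in>{0..N}. dist (poly (q n) t) (t powr p) < e) \<and>
          L2_opnorm M (\<lambda>f x. op_poly (q n) A f x - B f x) < e"
        by (rule eventually_conj[OF uniform_limitD[OF q e] order_tendstoD(2)[OF lim e]])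
      then obtain m where m: "\<forall>t\<in>{0..N}. dist (poly (q m) t) (t powr p) < e"
          "L2_opnorm M (\<lambda>f x. op_poly (q m) A f x - B f x) < e"
        unfolding eventually_sequentially by blast
      define Q where "Q = op_poly (q m) A"
      have QB0: "L2_has_bound M (\<lambda>f x. Q f x - B0 f x) (4 * e)"
        unfolding Q_def by (rule approx) (use e m(1) in \<open>auto simp: dist_real_def less_imp_le\<close>)
      have "L2_has_bound M (\<lambda>f x. (Q f x - B0 f x) - (B f x - B0 f x)) (2 * (4 * e + 2 * (c1 + c0)))"
        by (rule L2_has_bound_diff[OF QB0 L2_has_bound_diff[OF c(2,1)]])
      then have QB: "L2_has_bound M (\<lambda>f x. Q f x - B f x) (2 * (4 * e + 2 * (c1 + c0)))" by simp
      have "L2_norm M (\<lambda>x. Q f x - B f x) \<le> e * ?n"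
        using L2_norm_le_opnorm[OF QB f] m(2) n unfolding Q_def[symmetric]
        by (meson less_imp_le mult_right_mono order_trans)
      then have 1: "(L2_norm M (\<lambda>x. Q f x - B f x))\<^sup>2 \<le> (e * ?n)\<^sup>2"
        by (intro power_mono L2_norm_nonneg)
      have 2: "(L2_norm M (\<lambda>x. Q f x - B0 f x))\<^sup>2 \<le> (4 * e * ?n)\<^sup>2"
        by (intro power_mono L2_norm_nonneg L2_has_boundD(3)[OF QB0 f])
      have "d = (\<lambda>x. (Q f x - B0 f x) - (Q f x - B f x))" by (simp add: d_def fun_eq_iff)
      then have "(L2_norm M d)\<^sup>2 \<le> 2 * (L2_norm M (\<lambda>x. Q f x - B0 f x))\<^sup>2 + 2 * (L2_norm M (\<lambda>x. Q f x - B f x))\<^sup>2"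
        using L2_diff(2)[OF L2_has_boundD(2)[OF QB0 f] L2_has_boundD(2)[OF QB f]] by simp
      also have "\<dots> \<le> 2 * (4 * e * ?n)\<^sup>2 + 2 * (e * ?n)\<^sup>2" using 1 2 by simp
      also have "\<dots> \<le> (e * (8 * ?n))\<^sup>2" by (simp add: power_mult_distrib)
      finally show ?thesis by (rule power2_le_imp_le) (use e n in simp)
    qed
    have "L2_norm M d \<le> 0"
    proof (rule field_le_epsilon)
      fix e :: real assume e: "0 < e"
      have "L2_norm M d \<le> e / (8 * ?n + 1) * (8 * ?n)"
        using e n by (intro le) (simp add: add_nonneg_pos)
      also have "\<dots> \<le> e" using e n by (simp add: field_simps)
      finally show "L2_norm M d \<le> 0 + e" by simp
    qed
    then have "L2_norm M d = 0" using L2_norm_nonneg[of M d] by simp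
    from L2_norm_eq_0_imp_AE[OF d_L2 this] show ?thesis by (simp add: d_def)
  qed
  then have "acts_as B (\<lambda>x. cnj (v x) * complex_of_real (s x powr p / b x)) v"
    by (simp add: acts_as_def B0_def)
  then show "acts_as (L2_op_powr M A p)
       (\<lambda>x. cnj (v x) * complex_of_real ((k x * enn2real (Esq v x)) powr p / enn2real (Esq v x))) v"
    unfolding B_def s_def b_def .
qed

section \<open>Quasihyponormality\<close>

lemma bounded_pair_cnj_self:
  assumes vw: "bounded_pair w v K"
  shows "bounded_pair (\<lambda>x. cnj (v x) * complex_of_real (enn2real (Esq w x))) v (K\<^sup>2)"
proof (rule bounded_pair_functional)
  show v: "v \<in> cond_L2" using vw by (simp add: bounded_pair_def)
  have w: "w \<in> cond_L2" using vw by (simp add: bounded_pair_def)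
  show "AE x in M. \<bar>enn2real (Esq w x) * enn2real (Esq v x)\<bar> \<le> K\<^sup>2"
    using vw[unfolded bounded_pair_def, THEN conjunct2, THEN conjunct2, THEN conjunct2]
  proof eventually_elim
    case (elim x)
    have "enn2real (Esq w x * Esq v x) \<le> enn2real (ennreal (K\<^sup>2))"
      by (rule enn2real_mono[OF elim]) simp
    then show ?case by (simp add: enn2real_mult)
  qed
qed auto

text \<open>
  The difference of the two operators in the definition of quasihyponormality has weights
  \<open>\<Delta> cnj u, u\<close>, hence the quadratic form \<open>\<integral> \<Delta> |E(u f)|\<^sup>2\<close>, and the sign of \<open>\<Delta>\<close> decides.
\<close>
lemma p_quasihyponormal_iff_pair:
  assumes T: "L2_bounded M T" "acts_as T w u" and wu: "bounded_pair w u K" and p: "0 < p"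
  shows "p_quasihyponormal M p T \<longleftrightarrow>
    (AE x in M. Esq u x * Esq w x \<le> ennreal ((cmod (E (\<lambda>y. u y * w y) x))\<^sup>2))"
proof -
  have w: "w \<in> cond_L2" and u: "u \<in> cond_L2" and K: "0 \<le> K"
    and leK: "AE x in M. Esq w x * Esq u x \<le> ennreal (K\<^sup>2)"
    using wu by (auto simp: bounded_pair_def)
  note cu = cond_L2_cnj[OF u] and cw = cond_L2_cnj[OF w]
  note [measurable] = cond_L2_measurable[OF w] cond_L2_measurable[OF u]
  define a where "a x = enn2real (Esq u x)" for x
  define h where "h x = enn2real (Esq w x)" for x
  define e where "e = E (\<lambda>y. u y * w y)"
  have [measurable]: "a \<in> borel_measurable F" "h \<in> borel_measurable F" "e \<in> borel_measurable F"
    unfolding a_def[abs_def] h_def[abs_def] e_def by measurable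
  have ah0: "0 \<le> a x" "0 \<le> h x" for x by (auto simp: a_def h_def)
  have ah: "AE x in M. Esq u x = ennreal (a x) \<and> Esq w x = ennreal (h x)"
    using cond_L2_finite[OF u] cond_L2_finite[OF w] by eventually_elim (simp add: a_def h_def)
  have CS: "AE x in M. (cmod (e x))\<^sup>2 \<le> a x * h x"
    using cond_Cauchy_Schwarz[OF u w] ah
    by eventually_elim (simp add: e_def ah0 flip: ennreal_mult)
  have ahK: "AE x in M. a x * h x \<le> K\<^sup>2"
    using leK ah by eventually_elim (simp add: ah0 mult.commute flip: ennreal_mult)

  define S where "S = L2_adjoint M T"
  have S: "L2_bounded M S" "acts_as S (\<lambda>x. cnj (u x)) (\<lambda>x. cnj (w x))"
    unfolding S_def by (rule adjoint_acts_as[OF T wu])+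
  have T_L2: "T f \<in> L2 M" and S_L2: "S f \<in> L2 M" if "f \<in> L2 M" for f
    using T(1) S(1) that by (auto simp: L2_bounded_def)

  have TS: "acts_as (T \<circ> S) (\<lambda>x. cnj (cnj (w x)) * complex_of_real (a x)) (\<lambda>x. cnj (w x))"
    by (rule acts_as_cong[OF acts_as_comp[OF T(2) S(2) S_L2 u cu]])
      (use E_mult_cnj_self[of u] in \<open>auto simp: a_def\<close>)
  have ST: "acts_as (S \<circ> T) (\<lambda>x. cnj (u x) * complex_of_real (h x)) u"
    by (rule acts_as_cong[OF acts_as_comp[OF S(2) T(2) T_L2 cw w]])
      (use E_mult_cnj_self[of w] in \<open>auto simp: h_def mult.commute[of "cnj (w _)"]\<close>)
  have TS_bound: "L2_has_bound M (T \<circ> S) (K\<^sup>2)"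
    using bounded_pair_cnj_self[OF bounded_pair_cnj[OF wu]] T_L2 S_L2
    by (intro has_bound_acts_as[OF TS]) (auto simp: a_def intro: L2_measurable)
  have ST_bound: "L2_has_bound M (S \<circ> T) (K\<^sup>2)"
    using bounded_pair_cnj_self[OF wu] T_L2 S_L2
    by (intro has_bound_acts_as[OF ST]) (auto simp: h_def intro: L2_measurable)

  \<comment> \<open>the real factors in the weights \<open>w m\<^sub>1, cnj w\<close> of \<open>(TT\<^sup>*)\<^sup>p\<close> and \<open>cnj u m\<^sub>2, u\<close> of \<open>(T\<^sup>*T)\<^sup>p\<close>\<close>
  define m1 where "m1 x = (a x * h x) powr p / h x" for x
  define m2 where "m2 x = (a x * h x) powr p / a x" for x
  have [measurable]: "m1 \<in> borel_measurable F" "m2 \<in> borel_measurable F"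
    unfolding m1_def[abs_def] m2_def[abs_def] by measurable
  define X where "X = L2_op_powr M (T \<circ> S) p"
  define Y where "Y = L2_op_powr M (S \<circ> T) p"
  have X: "L2_bounded M X" "acts_as X (\<lambda>x. complex_of_real (m1 x) * w x) (\<lambda>x. cnj (w x))"
    using op_powr_acts_as[OF cw _ ah0(1) TS_bound TS p]
    by (simp_all add: X_def m1_def h_def mult.commute[of "w _"])
  have Y: "L2_bounded M Y" "acts_as Y (\<lambda>x. complex_of_real (m2 x) * cnj (u x)) u"
    using op_powr_acts_as[OF u _ ah0(2) ST_bound ST p]
    by (simp_all add: Y_def m2_def a_def mult.commute[of "cnj (u _)"] mult.commute[of "h _"])
  have X_L2: "X f \<in> L2 M" and Y_L2: "Y f \<in> L2 M" if "f \<in> L2 M" for f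
    using X(1) Y(1) that by (auto simp: L2_bounded_def)
  have mw: "(\<lambda>x. complex_of_real (m1 x) * w x) \<in> cond_L2" and mu: "(\<lambda>x. complex_of_real (m2 x) * cnj (u x)) \<in> cond_L2"
    by (intro cond_L2_mult w cu; measurable)+

  have SXT: "acts_as (S \<circ> X \<circ> T) (\<lambda>x. cnj (u x) * complex_of_real (m1 x * (h x)\<^sup>2)) u"
  proof (rule acts_as_cong[OF acts_as_comp[OF acts_as_comp[OF S(2) X(2) X_L2 cw mw] T(2) T_L2 cw w]])
    have "AE x in M. E (\<lambda>y. cnj (w y) * (complex_of_real (m1 y) * w y)) x = complex_of_real (m1 x) * complex_of_real (h x)"
      using E_mult_cnj_scaled[OF cw, of "\<lambda>x. complex_of_real (m1 x)"] by (simp add: h_def)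
    moreover have "AE x in M. E (\<lambda>y. cnj (w y) * w y) x = complex_of_real (h x)"
      using E_mult_cnj_self[of "\<lambda>x. cnj (w x)"] by (simp add: h_def)
    ultimately show "AE x in M. cnj (u x) * E (\<lambda>y. cnj (w y) * (complex_of_real (m1 y) * w y)) x * E (\<lambda>y. cnj (w y) * w y) x
        = cnj (u x) * complex_of_real (m1 x * (h x)\<^sup>2)"
      by eventually_elim (simp add: power2_eq_square)
  qed
  have SYT: "acts_as (S \<circ> Y \<circ> T) (\<lambda>x. cnj (u x) * complex_of_real (m2 x * (cmod (e x))\<^sup>2)) u"
  proof (rule acts_as_cong[OF acts_as_comp[OF acts_as_comp[OF S(2) Y(2) Y_L2 cw mu] T(2) T_L2 u w]])
    have "AE x in M. E (\<lambda>y. cnj (w y) * (complex_of_real (m2 y) * cnj (u y))) x = complex_of_real (m2 x) * E (\<lambda>y. cnj (w y) * cnj (u y)) x"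
      by (intro E_mult_scale_right cw cu) measurable
    then show "AE x in M. cnj (u x) * E (\<lambda>y. cnj (w y) * (complex_of_real (m2 y) * cnj (u y))) x * E (\<lambda>y. u y * w y) x
        = cnj (u x) * complex_of_real (m2 x * (cmod (e x))\<^sup>2)"
    proof eventually_elim
      case (elim x)
      have "E (\<lambda>y. cnj (w y) * cnj (u y)) x = cnj (e x)"
        using E_cnj[of "\<lambda>y. u y * w y"] by (simp add: e_def mult.commute)
      then show ?case
        using elim complex_norm_square[of "e x"] by (simp add: e_def mult_ac)
    qed
  qed

  \<comment> \<open>equals \<open>(a h)\<^sup>p (|e|\<^sup>2/a - h)\<close>, and \<open>0\<close> where \<open>a h = 0\<close>\<close>
  define \<Delta> where "\<Delta> x = m2 x * (cmod (e x))\<^sup>2 - m1 x * (h x)\<^sup>2" for x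
  have [measurable]: "\<Delta> \<in> borel_measurable F" unfolding \<Delta>_def[abs_def] by measurable
  have [measurable]: "\<Delta> \<in> borel_measurable M" by (rule F_imp_M) measurable
  have \<Delta>_pair: "bounded_pair (\<lambda>x. cnj (u x) * complex_of_real (\<Delta> x)) u ((K\<^sup>2) powr p * K\<^sup>2)"
  proof (rule bounded_pair_functional[OF u])
    show "AE x in M. \<bar>\<Delta> x * enn2real (Esq u x)\<bar> \<le> (K\<^sup>2) powr p * K\<^sup>2"
      using CS ahK
    proof eventually_elim
      case (elim x)
      let ?L = "(K\<^sup>2) powr p * K\<^sup>2"
      have pw: "(a x * h x) powr p \<le> (K\<^sup>2) powr p" using elim(2) ah0 p by (intro powr_mono2) auto
      have "m2 x * (cmod (e x))\<^sup>2 * a x \<le> (a x * h x) powr p * (a x * h x)"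
        using elim(1) ah0 by (auto simp: m2_def intro: mult_left_mono)
      also have "\<dots> \<le> ?L" using pw elim(2) ah0 by (intro mult_mono) auto
      finally have 1: "m2 x * (cmod (e x))\<^sup>2 * a x \<le> ?L" .
      have "m1 x * (h x)\<^sup>2 * a x \<le> (a x * h x) powr p * (a x * h x)"
        by (auto simp: m1_def power2_eq_square)
      also have "\<dots> \<le> ?L" using pw elim(2) ah0 by (intro mult_mono) auto
      finally have 2: "m1 x * (h x)\<^sup>2 * a x \<le> ?L" .
      have "0 \<le> m2 x * (cmod (e x))\<^sup>2 * a x" "0 \<le> m1 x * (h x)\<^sup>2 * a x"
        using ah0 by (simp_all add: m1_def m2_def)
      then show ?case using 1 2 by (simp add: \<Delta>_def a_def[symmetric] left_diff_distrib abs_le_iff)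
    qed
  qed auto

  have form: "integrable M (\<lambda>x. \<Delta> x * (cmod (E (\<lambda>y. u y * f y) x))\<^sup>2)"
    "L2_inner M (\<lambda>x. (S \<circ> Y \<circ> T) f x - (S \<circ> X \<circ> T) f x) f
       = complex_of_real (LINT x|M. \<Delta> x * (cmod (E (\<lambda>y. u y * f y) x))\<^sup>2)" if f: "f \<in> L2 M" for f
  proof -
    let ?w = "\<lambda>x. cnj (u x) * complex_of_real (\<Delta> x)" and ?e = "E (\<lambda>y. u y * f y)"
    note [measurable] = L2_measurable[OF f]
    have L: "(S \<circ> Y \<circ> T) f \<in> L2 M" "(S \<circ> X \<circ> T) f \<in> L2 M"
      using f by (auto intro!: S_L2 X_L2 Y_L2 T_L2)
    have "AE x in M. (S \<circ> Y \<circ> T) f x - (S \<circ> X \<circ> T) f x = wEu ?w u f x"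
      using acts_asD[OF SXT f] acts_asD[OF SYT f]
      by eventually_elim (simp add: weighted_cond_op_def \<Delta>_def algebra_simps)
    then have 1: "L2_inner M (\<lambda>x. (S \<circ> Y \<circ> T) f x - (S \<circ> X \<circ> T) f x) f = L2_inner M (wEu ?w u f) f"
      by (rule L2_inner_cong_AE[rotated 2])
        (use L2_measurable[OF L(1)] L2_measurable[OF L(2)] in \<open>auto intro!: wEu_measurable\<close>)
    have "AE x in M. E (\<lambda>y. cnj (u y) * (complex_of_real (\<Delta> y) * cnj (f y))) x
        = complex_of_real (\<Delta> x) * E (\<lambda>y. cnj (u y) * cnj (f y)) x"
      by (intro E_mult_scale_right cu cond_L2_cnj L2_imp_cond_L2 f) measurable
    then have ae: "AE x in M. ?e x * E (\<lambda>y. ?w y * cnj (f y)) x = complex_of_real (\<Delta> x * (cmod (?e x))\<^sup>2)"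
    proof eventually_elim
      case (elim x)
      have "E (\<lambda>y. cnj (u y) * cnj (f y)) x = cnj (?e x)"
        using E_cnj[of "\<lambda>y. u y * f y"] by simp
      then show ?case using elim complex_norm_square[of "?e x"] by (simp add: mult_ac)
    qed
    note inner = L2_inner_wEu[OF \<Delta>_pair f f]
    have int: "integrable M (\<lambda>x. complex_of_real (\<Delta> x * (cmod (?e x))\<^sup>2))"
      by (rule integrable_cong_AE_imp[OF inner(1) _ ae]) measurable
    then show "integrable M (\<lambda>x. \<Delta> x * (cmod (?e x))\<^sup>2)"
      unfolding complex_of_real_integrable_eq .
    have "L2_inner M (wEu ?w u f) f = (LINT x|M. complex_of_real (\<Delta> x * (cmod (?e x))\<^sup>2))"
      unfolding inner(2) by (rule integral_cong_AE) (use ae in auto)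
    then show "L2_inner M (\<lambda>x. (S \<circ> Y \<circ> T) f x - (S \<circ> X \<circ> T) f x) f
        = complex_of_real (LINT x|M. \<Delta> x * (cmod (?e x))\<^sup>2)"
      unfolding 1 integral_complex_of_real .
  qed

  have iff: "p_quasihyponormal M p T \<longleftrightarrow> (\<forall>f\<in>L2 M. 0 \<le> (LINT x|M. \<Delta> x * (cmod (E (\<lambda>y. u y * f y) x))\<^sup>2))"
    unfolding p_quasihyponormal_def L2_op_le_def S_def[symmetric] X_def[symmetric] Y_def[symmetric]
    using T(1) by (simp add: form(2) del: comp_apply)
  show ?thesis
  proof
    assume ineq: "AE x in M. Esq u x * Esq w x \<le> ennreal ((cmod (E (\<lambda>y. u y * w y) x))\<^sup>2)"
    have "AE x in M. 0 \<le> \<Delta> x"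
      using ineq ah
    proof eventually_elim
      case (elim x)
      have le: "a x * h x \<le> (cmod (e x))\<^sup>2"
        using elim by (simp add: ah0 e_def flip: ennreal_mult)
      show ?case
      proof (cases "a x = 0 \<or> h x = 0")
        case False
        then have pos: "0 < a x" "0 < h x" using ah0[of x] by auto
        have "h x \<le> (cmod (e x))\<^sup>2 / a x" using le pos by (simp add: field_simps)
        then have "(a x * h x) powr p * h x \<le> (a x * h x) powr p * ((cmod (e x))\<^sup>2 / a x)"
          by (rule mult_left_mono) simp
        then show ?thesis using pos by (simp add: \<Delta>_def m1_def m2_def power2_eq_square[of "h x"])
      qed (auto simp: \<Delta>_def m1_def m2_def)
    qed
    then show "p_quasihyponormal M p T"
      unfolding iff by (auto intro!: integral_nonneg_AE elim!: eventually_mono)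
  next
    assume "p_quasihyponormal M p T"
    then have nonneg: "0 \<le> (LINT x|M. \<Delta> x * (cmod (E (\<lambda>y. u y * f y) x))\<^sup>2)" if "f \<in> L2 M" for f
      using that iff by blast
    have "AE x in M. 0 \<le> \<Delta> x * (a x)\<^sup>2"
    proof (rule AE_localize[OF _ cond_L2_finite[OF u]])
      fix A n assume A[measurable]: "A \<in> sets F" and Afin: "emeasure M A < \<infinity>" and n: "\<And>x. x \<in> A \<Longrightarrow> Esq u x \<le> of_nat n"
      \<comment> \<open>\<open>f = cnj u 1\<^sub>D\<close> has \<open>E(u f) = a 1\<^sub>D\<close>\<close>
      define D where "D = A \<inter> {x \<in> space F. \<Delta> x * (a x)\<^sup>2 < 0}"
      have D[measurable]: "D \<in> sets F" unfolding D_def by measurable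
      note [measurable] = sets_F_imp_M[OF D]
      define f where "f x = indicator D x * cnj (u x)" for x
      have [measurable]: "f \<in> borel_measurable M" unfolding f_def[abs_def] by measurable
      have "(\<integral>\<^sup>+x. ennreal ((cmod (f x))\<^sup>2) \<partial>M) = (\<integral>\<^sup>+x. indicator D x * Esq u x \<partial>M)"
        by (subst nn_integral_Esq) (auto intro!: nn_integral_cong simp: f_def indicator_def)
      also have "\<dots> \<le> (\<integral>\<^sup>+x. of_nat n * indicator A x \<partial>M)"
        by (intro nn_integral_mono) (auto simp: indicator_def n D_def)
      also have "\<dots> = of_nat n * emeasure M A" by (rule nn_integral_cmult_indicator[OF sets_F_imp_M[OF A]])
      also have "\<dots> < \<infinity>" using Afin by (simp add: ennreal_mult_less_top of_nat_less_top)
      finally have f: "f \<in> L2 M" by (simp add: L2_iff)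
      have "AE x in M. E (\<lambda>y. u y * (indicator D y * cnj (u y))) x = indicator D x * complex_of_real (enn2real (Esq u x))"
        by (rule E_mult_cnj_scaled[OF u]) measurable
      then have ae: "AE x in M. \<Delta> x * (cmod (E (\<lambda>y. u y * f y) x))\<^sup>2 = indicator D x * (\<Delta> x * (a x)\<^sup>2)"
        unfolding f_def[symmetric] a_def[symmetric]
        by eventually_elim (auto simp: indicator_def norm_mult ah0)
      have [measurable]: "a \<in> borel_measurable M" by (rule F_imp_M) measurable
      have int: "integrable M (\<lambda>x. indicator D x * (\<Delta> x * (a x)\<^sup>2))"
        by (rule integrable_cong_AE_imp[OF form(1)[OF f] _ ae]) measurable
      have "(LINT x|M. indicator D x * (\<Delta> x * (a x)\<^sup>2)) = (LINT x|M. \<Delta> x * (cmod (E (\<lambda>y. u y * f y) x))\<^sup>2)"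
        by (rule integral_cong_AE) (use ae in auto)
      then have "0 \<le> (LINT x|M. indicator D x * (\<Delta> x * (a x)\<^sup>2))" using nonneg[OF f] by simp
      then have le: "(LINT x|M. - (indicator D x * (\<Delta> x * (a x)\<^sup>2))) \<le> 0" by simp
      have D_nonneg: "AE x in M. 0 \<le> - (indicator D x * (\<Delta> x * (a x)\<^sup>2))"
        by (auto simp: indicator_def D_def)
      have "(LINT x|M. - (indicator D x * (\<Delta> x * (a x)\<^sup>2))) = 0"
        using le integral_nonneg_AE[OF D_nonneg] by linarith
      then have "AE x in M. - (indicator D x * (\<Delta> x * (a x)\<^sup>2)) = 0"
        using integral_nonneg_eq_0_iff_AE[OF Bochner_Integration.integrable_minus[OF int]] D_nonneg by blast
      then show "AE x in M. x \<in> A \<longrightarrow> 0 \<le> \<Delta> x * (a x)\<^sup>2"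
        using AE_space
      proof eventually_elim
        case (elim x)
        show ?case
        proof (intro impI, rule ccontr)
          assume "x \<in> A" and neg: "\<not> 0 \<le> \<Delta> x * (a x)\<^sup>2"
          then have "x \<in> D" using elim(2) subalg by (auto simp: D_def subalgebra_def)
          then show False using elim(1) neg by auto
        qed
      qed
    qed measurable
    then show "AE x in M. Esq u x * Esq w x \<le> ennreal ((cmod (E (\<lambda>y. u y * w y) x))\<^sup>2)"
      using ah
    proof eventually_elim
      case (elim x)
      have "a x * h x \<le> (cmod (e x))\<^sup>2"
      proof (cases "a x = 0 \<or> h x = 0")
        case False
        then have pos: "0 < a x" "0 < h x" using ah0[of x] by auto
        then have "0 \<le> \<Delta> x" using elim(1) by (simp add: zero_le_mult_iff)
        then have "(a x * h x) powr p * h x \<le> (a x * h x) powr p * ((cmod (e x))\<^sup>2 / a x)"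
          using pos by (simp add: \<Delta>_def m1_def m2_def power2_eq_square[of "h x"])
        then have "h x \<le> (cmod (e x))\<^sup>2 / a x"
          using pos by (subst (asm) mult_le_cancel_left_pos) auto
        then show ?thesis using pos by (simp add: field_simps)
      qed auto
      then have "ennreal (a x * h x) \<le> ennreal ((cmod (e x))\<^sup>2)" by (rule ennreal_leI)
      then show ?case using elim(2) by (simp add: e_def ah0 ennreal_mult)
    qed
  qed
qed

lemma AE_eq_0_if_Esq_eq_0:
  assumes [measurable]: "u \<in> borel_measurable M"
  shows "AE x in M. Esq u x = 0 \<longrightarrow> u x = 0"
proof -
  define Z where "Z = {x \<in> space F. Esq u x = 0}"
  have Z[measurable]: "Z \<in> sets F" unfolding Z_def by measurable
  note [measurable] = sets_F_imp_M[OF Z]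
  have "(\<integral>\<^sup>+x. indicator Z x * ennreal ((cmod (u x))\<^sup>2) \<partial>M) = (\<integral>\<^sup>+x. indicator Z x * Esq u x \<partial>M)"
    by (rule nn_integral_Esq[symmetric]) measurable
  also have "\<dots> = (\<integral>\<^sup>+x. 0 \<partial>M)"
    by (intro nn_integral_cong) (auto simp: indicator_def Z_def)
  finally have "AE x in M. indicator Z x * ennreal ((cmod (u x))\<^sup>2) = 0"
    by (subst nn_integral_0_iff_AE[symmetric]) auto
  then show ?thesis using AE_space
    by eventually_elim (use subalg in \<open>auto simp: Z_def subalgebra_def indicator_def ennreal_eq_0_iff split: if_splits\<close>)
qed

text \<open>
  Cutting \<open>u\<close> and \<open>w\<close> off where \<open>E(|w|\<^sup>2)\<close> and \<open>E(|u|\<^sup>2)\<close> vanish reduces the claim to weights with finite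
  \<open>E(|u|\<^sup>2)\<close> and \<open>E(|w|\<^sup>2)\<close>.
\<close>
theorem p_quasihyponormal_iff:
  assumes u: "u \<in> dom_E" and w: "w \<in> dom_E"
    and uf: "\<forall>f\<in>L2 M. (\<lambda>x. u x * f x) \<in> dom_E"
    and T: "L2_bounded M (wEu w u)" and p: "0 < p"
  shows "p_quasihyponormal M p (wEu w u) \<longleftrightarrow>
    (AE x in M. Esq u x * Esq w x \<le> ennreal ((cmod (E (\<lambda>y. u y * w y) x))\<^sup>2))"
proof -
  note [measurable] = dom_E_measurable[OF u] dom_E_measurable[OF w]
  obtain C where C: "L2_has_bound M (wEu w u) C" by (rule L2_bounded_has_bound[OF T])
  have ah: "AE x in M. Esq w x * Esq u x \<le> ennreal (C\<^sup>2)"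
    by (rule Esq_mult_Esq_le) (use C in \<open>auto simp: L2_has_bound_def\<close>)
  define A where "A = {x \<in> space F. Esq u x \<noteq> 0}"
  define H where "H = {x \<in> space F. Esq w x \<noteq> 0}"
  have A[measurable]: "A \<in> sets F" and H[measurable]: "H \<in> sets F"
    unfolding A_def H_def by measurable
  note [measurable] = sets_F_imp_M[OF A] sets_F_imp_M[OF H]
  define u' where "u' x = indicator H x * u x" for x
  define w' where "w' x = indicator A x * w x" for x
  have [measurable]: "u' \<in> borel_measurable M" "w' \<in> borel_measurable M"
    unfolding u'_def[abs_def] w'_def[abs_def] by measurable
  have AH: "AE x in M. (x \<in> A \<longleftrightarrow> Esq u x \<noteq> 0) \<and> (x \<in> H \<longleftrightarrow> Esq w x \<noteq> 0)"
    using AE_space by eventually_elim (use subalg in \<open>auto simp: A_def H_def subalgebra_def\<close>)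
  have Esq_u': "AE x in M. Esq u' x = indicator H x * Esq u x"
  proof -
    have "AE x in M. Esq u' x = ennreal ((cmod (indicator H x))\<^sup>2) * Esq u x"
      unfolding u'_def[abs_def] by (rule Esq_mult) measurable
    then show ?thesis by eventually_elim (auto simp: indicator_def)
  qed
  have Esq_w': "AE x in M. Esq w' x = indicator A x * Esq w x"
  proof -
    have "AE x in M. Esq w' x = ennreal ((cmod (indicator A x))\<^sup>2) * Esq w x"
      unfolding w'_def[abs_def] by (rule Esq_mult) measurable
    then show ?thesis by eventually_elim (auto simp: indicator_def)
  qed
  \<comment> \<open>consequently \<open>E(u f)\<close> vanishes off \<open>A\<close> and \<open>w\<close> off \<open>H\<close>: the cut-offs do not change \<open>w E(u f)\<close>\<close>
  have u0: "AE x in M. x \<notin> A \<longrightarrow> u x = 0" and w0: "AE x in M. x \<notin> H \<longrightarrow> w x = 0"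
    using AE_eq_0_if_Esq_eq_0[of u] AE_eq_0_if_Esq_eq_0[of w] AH by (auto elim: eventually_elim2)
  have fin: "AE x in M. Esq u' x < \<infinity> \<and> Esq w' x < \<infinity>"
    using Esq_u' Esq_w' AH ah
  proof eventually_elim
    case (elim x)
    have "Esq w x * Esq u x < \<infinity>" using elim(4) by (auto intro: le_less_trans)
    then show ?case using elim(1-3) by (auto simp: indicator_def ennreal_mult_less_top)
  qed
  have prod: "AE x in M. Esq u' x * Esq w' x = Esq u x * Esq w x"
    using Esq_u' Esq_w' AH by eventually_elim (auto simp: indicator_def)
  have "AE x in M. Esq w' x * Esq u' x \<le> ennreal (C\<^sup>2)"
    using prod ah by eventually_elim (simp add: mult.commute)
  then have pair: "bounded_pair w' u' C"
    using fin C by (auto simp: bounded_pair_def cond_L2_def L2_has_bound_def)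
  have "acts_as (wEu w u) w' u'"
    unfolding acts_as_def weighted_cond_op_def
  proof
    fix f assume f: "f \<in> L2 M"
    note [measurable] = L2_measurable[OF f]
    have d: "(\<lambda>x. u x * f x) \<in> dom_E" using uf f by blast
    have "AE x in M. E (\<lambda>y. indicator H y * (u y * f y)) x = indicator H x * E (\<lambda>y. u y * f y) x"
      by (rule E_mult[OF _ d]) measurable
    moreover have "AE x in M. E (\<lambda>y. indicator A y * (u y * f y)) x = indicator A x * E (\<lambda>y. u y * f y) x"
      by (rule E_mult[OF _ d]) measurable
    moreover have "AE x in M. E (\<lambda>y. indicator A y * (u y * f y)) x = E (\<lambda>y. u y * f y) x"
      by (rule E_cong) (use u0 in \<open>auto elim!: eventually_mono simp: indicator_def\<close>)
    ultimately show "AE x in M. w x * E (\<lambda>y. u y * f y) x = w' x * E (\<lambda>y. u' y * f y) x"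
      using w0
      by eventually_elim (auto simp: u'_def w'_def indicator_def mult.assoc split: if_splits)
  qed
  from p_quasihyponormal_iff_pair[OF T this pair p]
  have "p_quasihyponormal M p (wEu w u) \<longleftrightarrow>
    (AE x in M. Esq u' x * Esq w' x \<le> ennreal ((cmod (E (\<lambda>y. u' y * w' y) x))\<^sup>2))" .
  moreover have "AE x in M. E (\<lambda>y. u' y * w' y) x = E (\<lambda>y. u y * w y) x"
  proof (rule E_cong)
    show "AE x in M. u' x * w' x = u x * w x"
      using u0 w0 by eventually_elim (auto simp: u'_def w'_def indicator_def)
  qed measurable
  ultimately show ?thesis
    using prod by (auto elim: eventually_elim2[OF eventually_conj])
qed

end

theorem theorem3p9:
  fixes M F :: "'a measure" and u w :: "'a \<Rightarrow> complex" and p :: real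
  assumes "complete_measure M"
    and "sigma_finite_measure M"
    and "sigma_finite_subalgebra M F"
    and "u \<in> cond_exp_dom M F"
    and "w \<in> cond_exp_dom M F"
    and "\<forall>f\<in>L2 M. (\<lambda>x. u x * f x) \<in> cond_exp_dom M F"
    and "L2_bounded M (weighted_cond_op M F w u)"
    and "0 < p"
  shows
    "((AE x in M. ennreal ((cmod (complex_cond_exp M F (\<lambda>y. u y * w y) x))\<^sup>2)
                   \<ge> cond_exp_sq M F u x * cond_exp_sq M F w x)
        \<longrightarrow> p_quasihyponormal M p (weighted_cond_op M F w u)) \<and>
     (p_quasihyponormal M p (weighted_cond_op M F w u)
        \<longrightarrow> (AE x in M. x \<in> support_on (space M) (complex_cond_exp M F u)
                           \<inter> support_on (space M) (cond_exp_sq M F w) \<longrightarrow>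
               ennreal ((cmod (complex_cond_exp M F (\<lambda>y. u y * w y) x))\<^sup>2)
                   \<ge> cond_exp_sq M F u x * cond_exp_sq M F w x)) \<and>
     ((AE x in M. x \<in> support_on (space M) w) \<and> (AE x in M. x \<in> support_on (space M) u)
        \<longrightarrow> (p_quasihyponormal M p (weighted_cond_op M F w u) \<longleftrightarrow>
              (AE x in M. ennreal ((cmod (complex_cond_exp M F (\<lambda>y. u y * w y) x))\<^sup>2)
                   \<ge> cond_exp_sq M F u x * cond_exp_sq M F w x)))"
proof -
  interpret sigma_finite_subalgebra M F by fact
  have "p_quasihyponormal M p (weighted_cond_op M F w u) \<longleftrightarrow>
      (AE x in M. ennreal ((cmod (complex_cond_exp M F (\<lambda>y. u y * w y) x))\<^sup>2)
                   \<ge> cond_exp_sq M F u x * cond_exp_sq M F w x)"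
    using assms by (intro p_quasihyponormal_iff)
  then show ?thesis by (auto elim: eventually_mono)
qed

end
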